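(* Let $\xi=(\xi_t)_{0\le t\le T}$ be progressively measurable with $\xi_0\in L^2(\mathbb P)$ and $\mathbb E\int_0^T\xi_t^2\,dt<\infty$, let $x\in\mathbb R$, and let $\Xi_T\in L^2(\mathcal F_T)$ satisfy the reachability condition $$\int_0^T\frac{d\,\mathbb E[\Xi_t^2]}{T-t}<\infty,\qquad \Xi_t:=\mathbb E[\Xi_T\mid\mathcal F_t].$$ Then for every $\kappa\in(0,T^2/4]$, with $a:=\sqrt\kappa$, $$v^{c}(\kappa)\le 6\bigl(\Omega(a)+\Theta(a)+a^2\Lambda(a)\bigr).$$
   Context: Fix $T>0$, a filtered probability space $(\Omega,\mathcal F,(\mathcal F_t)_{0\le t\le T},\mathbb P)$ satisfying the usual conditions, and $x\in\mathbb R$. Let $\mathcal U$ be the set of progressively measurable processes $u$ on $[0,T]$ with $\mathbb E\int_0^T u_t^2\,dt<\infty$; for $u\in\mathcal U$ let $X^u_t=x+\int_0^tu_s\,ds$ and, for $\kappa\ge0$, $$J_\kappa(u)=\mathbb E\Big[\tfrac12\int_0^T(X^u_t-\xi_t)^2\,dt+\tfrac\kappa2\int_0^Tu_t^2\,dt\Big].$$ $(\Xi_t)_{0\le t\le T}$ is the càdlàg version of the martingale $\mathbb E[\Xi_T\mid\mathcal F_t]$. The constrained value is $v^c(\kappa)=\inf_{u\in\mathcal U^c}J_\kappa(u)$, where $\mathcal U^c=\{u\in\mathcal U: X^u_T=\Xi_T\ \mathbb P\text{-a.s.}\}$. For $h>0$, $\omega_\xi(h)=\mathbb E\int_0^T|\xi_t-\xi_{(t-h)^+}|^2\,dt$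 with $(t-h)^+=\max\{t-h,0\}$. For $0<a\le T/2$, $$\Omega(a)=a\,\mathbb E[(x-\xi_0)^2]+\frac2a\int_0^\infty e^{-h/a}\omega_\xi(h)\,dh,$$ $$\Theta(a)=\mathbb E\int_{T-2a}^T|\xi_t-\Xi_t|^2\,dt,\qquad \Lambda(a)=\int_{T-2a}^T\frac{d\,\mathbb E[\Xi_t^2]}{T-t}.$$ The integrals with respect to $d\,\mathbb E[\Xi_t^2]$ are Stieltjes integrals with respect to the nondecreasing function $t\mapsto\mathbb E[\Xi_t^2]$ on $[0,T]$, with the convention that an atom of $d\,\mathbb E[\Xi_t^2]$ at $T$ contributes $+\infty$. *)

theory Defs
  imports "HOL-Probability.Probability"
begin

text \<open>
  The library locale \<open>filtration\<close> is indexed by a whole type; here the time set is \<open>[0, T]\<close>.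
  The measures \<open>F t\<close> only serve as carriers of \<open>\<sigma>\<close>-algebras, and values of the filtration and of
  processes at times outside \<open>[0, T]\<close> are irrelevant. Completeness of \<open>M\<close> itself follows from
  \<open>complete\<close> and \<open>subalg\<close>.
\<close>

locale usual_filtered_prob_space = prob_space M
  for M :: "'a measure" +
  fixes F :: "real \<Rightarrow> 'a measure" and T :: real
  assumes T_pos: "0 < T"
    and subalg: "\<And>t. t \<in> {0..T} \<Longrightarrow> subalgebra M (F t)"
    and mono: "\<And>s t. 0 \<le> s \<Longrightarrow> s \<le> t \<Longrightarrow> t \<le> T \<Longrightarrow> sets (F s) \<subseteq> sets (F t)"
    and complete: "\<And>N A. N \<in> null_sets M \<Longrightarrow> A \<subseteq> N \<Longrightarrow> A \<in> sets (F 0)"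
    and right_cont: "\<And>t. 0 \<le> t \<Longrightarrow> t < T \<Longrightarrow> sets (F t) = (\<Inter>s\<in>{t<..T}. sets (F s))"

definition progressive :: "(real \<Rightarrow> 'a measure) \<Rightarrow> real \<Rightarrow> (real \<Rightarrow> 'a \<Rightarrow> real) \<Rightarrow> bool" where
  "progressive F T u \<longleftrightarrow>
     (\<forall>t\<in>{0..T}. (\<lambda>(s, \<omega>). u s \<omega>) \<in> borel_measurable (restrict_space borel {0..t} \<Otimes>\<^sub>M F t))"

definition mean_sq_energy :: "'a measure \<Rightarrow> real \<Rightarrow> (real \<Rightarrow> 'a \<Rightarrow> real) \<Rightarrow> ennreal" where
  "mean_sq_energy M T u = (\<integral>\<^sup>+\<omega>. (\<integral>\<^sup>+t\<in>{0..T}. ennreal ((u t \<omega>)\<^sup>2) \<partial>lborel) \<partial>M)"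

definition controls :: "'a measure \<Rightarrow> (real \<Rightarrow> 'a measure) \<Rightarrow> real \<Rightarrow> (real \<Rightarrow> 'a \<Rightarrow> real) set" where
  "controls M F T = {u. progressive F T u \<and> mean_sq_energy M T u < \<infinity>}"

text \<open>
  For a control, the path \<open>u(\<omega>)\<close> is integrable on \<open>[0, T]\<close> for almost every \<open>\<omega>\<close>; on the exceptional
  null set the Bochner integral below is \<open>0\<close> by convention, which affects neither the cost nor the
  constraint.
\<close>

definition state :: "real \<Rightarrow> (real \<Rightarrow> 'a \<Rightarrow> real) \<Rightarrow> real \<Rightarrow> 'a \<Rightarrow> real" where
  "state x u t \<omega> = x + (LBINT s:{0..t}. u s \<omega>)"

definition cost :: "'a measure \<Rightarrow> real \<Rightarrow> real \<Rightarrow> (real \<Rightarrow> 'a \<Rightarrow> real) \<Rightarrow> real \<Rightarrow> (real \<Rightarrow> 'a \<Rightarrow> real) \<Rightarrow> ennreal"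
  where
  "cost M T x \<xi> \<kappa> u =
     (\<integral>\<^sup>+\<omega>. (ennreal (1 / 2) * (\<integral>\<^sup>+t\<in>{0..T}. ennreal ((state x u t \<omega> - \<xi> t \<omega>)\<^sup>2) \<partial>lborel)
           + ennreal (\<kappa> / 2) * (\<integral>\<^sup>+t\<in>{0..T}. ennreal ((u t \<omega>)\<^sup>2) \<partial>lborel)) \<partial>M)"

definition constrained_controls ::
  "'a measure \<Rightarrow> (real \<Rightarrow> 'a measure) \<Rightarrow> real \<Rightarrow> real \<Rightarrow> ('a \<Rightarrow> real) \<Rightarrow> (real \<Rightarrow> 'a \<Rightarrow> real) set" where
  "constrained_controls M F T x \<Xi>T = {u \<in> controls M F T. AE \<omega> in M. state x u T \<omega> = \<Xi>T \<omega>}"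

text \<open>The infimum is taken in \<open>ennreal\<close>, so it is \<open>\<infinity>\<close> when there is no admissible control.\<close>

definition constrained_value ::
  "'a measure \<Rightarrow> (real \<Rightarrow> 'a measure) \<Rightarrow> real \<Rightarrow> real \<Rightarrow> (real \<Rightarrow> 'a \<Rightarrow> real) \<Rightarrow> ('a \<Rightarrow> real) \<Rightarrow> real \<Rightarrow> ennreal"
  where
  "constrained_value M F T x \<xi> \<Xi>T \<kappa> = (INF u\<in>constrained_controls M F T x \<Xi>T. cost M T x \<xi> \<kappa> u)"

definition cadlag_on :: "real \<Rightarrow> (real \<Rightarrow> real) \<Rightarrow> bool" where
  "cadlag_on T f \<longleftrightarrow>
     (\<forall>t\<in>{0..<T}. continuous (at_right t) f) \<and> (\<forall>t\<in>{0<..T}. \<exists>l. (f \<longlongrightarrow> l) (at_left t))"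

definition cadlag_martingale_version ::
  "'a measure \<Rightarrow> (real \<Rightarrow> 'a measure) \<Rightarrow> real \<Rightarrow> ('a \<Rightarrow> real) \<Rightarrow> (real \<Rightarrow> 'a \<Rightarrow> real) \<Rightarrow> bool" where
  "cadlag_martingale_version M F T \<Xi>T \<Xi> \<longleftrightarrow>
     (\<forall>t\<in>{0..T}. \<Xi> t \<in> borel_measurable (F t) \<and> (AE \<omega> in M. \<Xi> t \<omega> = real_cond_exp M (F t) \<Xi>T \<omega>)) \<and>
     (\<forall>\<omega>\<in>space M. cadlag_on T (\<lambda>t. \<Xi> t \<omega>))"

text \<open>
  The Stieltjes measure of \<open>t \<mapsto> E[\<Xi>\<^sub>t\<^sup>2]\<close> on \<open>[0, T]\<close>; the function is extended by its boundary
  values to the real line, which adds no mass (in particular no atom at \<open>0\<close>), and a jump at \<open>T\<close>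
  becomes an atom at \<open>T\<close>.
\<close>

definition second_moment_measure :: "'a measure \<Rightarrow> real \<Rightarrow> (real \<Rightarrow> 'a \<Rightarrow> real) \<Rightarrow> real measure" where
  "second_moment_measure M T \<Xi> =
     interval_measure (\<lambda>t. integral\<^sup>L M (\<lambda>\<omega>. (\<Xi> (max 0 (min t T)) \<omega>)\<^sup>2))"

text \<open>
  The integral from \<open>s\<close> to \<open>T\<close> of \<open>d E[\<Xi>\<^sub>t\<^sup>2] / (T - t)\<close>, over \<open>(s, T]\<close> as usual for a right-continuous
  integrator. In \<open>ennreal\<close>, \<open>1 / 0 = \<infinity>\<close> and \<open>\<infinity> * 0 = 0\<close>, so an atom at \<open>T\<close> contributes \<open>\<infinity>\<close> and the
  endpoint \<open>T\<close> contributes nothing otherwise.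
\<close>

definition reach_integral :: "'a measure \<Rightarrow> real \<Rightarrow> (real \<Rightarrow> 'a \<Rightarrow> real) \<Rightarrow> real \<Rightarrow> ennreal" where
  "reach_integral M T \<Xi> s = (\<integral>\<^sup>+t\<in>{s<..T}. (1 / ennreal (T - t)) \<partial>second_moment_measure M T \<Xi>)"

definition sq_modulus :: "'a measure \<Rightarrow> real \<Rightarrow> (real \<Rightarrow> 'a \<Rightarrow> real) \<Rightarrow> real \<Rightarrow> ennreal" where
  "sq_modulus M T \<xi> h =
     (\<integral>\<^sup>+\<omega>. (\<integral>\<^sup>+t\<in>{0..T}. ennreal (\<bar>\<xi> t \<omega> - \<xi> (max (t - h) 0) \<omega>\<bar>\<^sup>2) \<partial>lborel) \<partial>M)"

definition Omega_term :: "'a measure \<Rightarrow> real \<Rightarrow> real \<Rightarrow> (real \<Rightarrow> 'a \<Rightarrow> real) \<Rightarrow> real \<Rightarrow> ennreal" where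
  "Omega_term M T x \<xi> a =
     ennreal a * (\<integral>\<^sup>+\<omega>. ennreal ((x - \<xi> 0 \<omega>)\<^sup>2) \<partial>M)
     + ennreal (2 / a) * (\<integral>\<^sup>+h\<in>{0<..}. (ennreal (exp (- h / a)) * sq_modulus M T \<xi> h) \<partial>lborel)"

definition Theta_term ::
  "'a measure \<Rightarrow> real \<Rightarrow> (real \<Rightarrow> 'a \<Rightarrow> real) \<Rightarrow> (real \<Rightarrow> 'a \<Rightarrow> real) \<Rightarrow> real \<Rightarrow> ennreal" where
  "Theta_term M T \<xi> \<Xi> a =
     (\<integral>\<^sup>+\<omega>. (\<integral>\<^sup>+t\<in>{T - 2 * a..T}. ennreal (\<bar>\<xi> t \<omega> - \<Xi> t \<omega>\<bar>\<^sup>2) \<partial>lborel) \<partial>M)"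

definition Lambda_term :: "'a measure \<Rightarrow> real \<Rightarrow> (real \<Rightarrow> 'a \<Rightarrow> real) \<Rightarrow> real \<Rightarrow> ennreal" where
  "Lambda_term M T \<Xi> a = reach_integral M T \<Xi> (T - 2 * a)"

end

theory Submission
  imports Defs
begin

text \<open>
  Until a switching time \<open>\<tau> \<in> [T - 2a, T - a]\<close> the control \<open>u = (\<xi> - X) / a\<close> lets \<open>X\<close> follow \<open>\<xi>\<close> by
  exponential smoothing. Then \<open>X - \<xi>\<close> is an exponentially weighted average of increments of \<open>\<xi>\<close> and the
  cost integrand equals \<open>(X - \<xi>)\<^sup>2\<close>, which Jensen's inequality bounds by \<open>\<Omega>(a)\<close>. Averaging over
  \<open>[T - 2a, T - a]\<close> yields a \<open>\<tau>\<close> with \<open>E (X\<^sub>\<tau> - \<Xi>\<^sub>\<tau>)\<^sup>2 \<le> (2/a) (\<Omega>(a) + \<Theta>(a))\<close>.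

  After \<open>\<tau>\<close> the state is piecewise linear on the dyadic times \<open>t\<^sub>k = T - (T - \<tau>) / 2\<^sup>k\<close>: from \<open>t\<^sub>k\<close> it heads
  for \<open>\<Xi>(t\<^sub>k)\<close>, to be reached at \<open>t\<^sub>k\<^sub>+\<^sub>1\<close>. This adapted control needs no stochastic integral: its cost only
  involves the increments \<open>E (\<Xi>(t\<^sub>k\<^sub>+\<^sub>1) - \<Xi>(t\<^sub>k))\<^sup>2 = E \<Xi>(t\<^sub>k\<^sub>+\<^sub>1)\<^sup>2 - E \<Xi>(t\<^sub>k)\<^sup>2\<close>, each at most \<open>T - t\<^sub>k\<close> times the
  part of \<open>\<Lambda>(a)\<close> between \<open>t\<^sub>k\<close> and \<open>t\<^sub>k\<^sub>+\<^sub>1\<close>. In total the cost is at most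
  \<open>4 \<Omega>(a) + 4 \<Theta>(a) + 5 a\<^sup>2 \<Lambda>(a)\<close>, and \<open>X\<^sub>T = \<Xi>\<^sub>T\<close> follows from Fatou's lemma.
\<close>

section \<open>Exponential smoothing of a path\<close>

text \<open>\<Omega>(a) and \<Theta>(a) are time integrals and say nothing about the error at a
  prescribed time, so the switching time cannot be fixed in advance. The window opens at T - 2a
  because \<Theta>(a) sees \<xi> - \<Xi> only from there on, and closes at T - a so that the first
  dyadic cell keeps a length between a/2 and a.

  The slope on a cell must be known when the cell begins. What \<Xi> reveals during a cell is
  therefore corrected only in the next one, which is half as long. The effort for this is an
  increment of E \<Xi>^2 divided by a length comparable to the distance to T, exactly the quantity
  summed by the reachability integral.

  Constants: the follower pays \<Omega>/2 for the deviation and \<Omega>/2 for the effort. After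
  \<tau> the deviation from \<xi> is split at \<Xi>, which costs \<Theta> once. The squared distance
  at \<tau> enters with weight 3a/2 and is at most (2/a) (\<Omega> + \<Theta>), which adds 3
  (\<Omega> + \<Theta>).\<close>

definition tracking :: "real \<Rightarrow> real \<Rightarrow> (real \<Rightarrow> real) \<Rightarrow> real \<Rightarrow> real" where
  "tracking a x f t = exp (- t / a) * x + (LBINT s:{0..t}. exp (- (t - s) / a) / a * f s)"

lemma LBINT_exp_decay:
  fixes a t :: real
  assumes "0 < a" "r \<le> t"
  shows "set_integrable lborel {r..t} (\<lambda>s. exp (- (s - r) / a) / a)"
    and "(LBINT s:{r..t}. exp (- (s - r) / a) / a) = 1 - exp (- (t - r) / a)"
proof -
  have "has_bochner_integral lborel (\<lambda>s. (exp (- (s - r) / a) / a) * indicator {r..t} s)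
     ((- exp (- (t - r) / a)) - (- exp (- (r - r) / a)))"
    using assms
    by (intro has_bochner_integral_FTC_Icc_real)
       (auto intro!: derivative_eq_intros continuous_intros simp: field_simps)
  then show "set_integrable lborel {r..t} (\<lambda>s. exp (- (s - r) / a) / a)"
    and "(LBINT s:{r..t}. exp (- (s - r) / a) / a) = 1 - exp (- (t - r) / a)"
    unfolding set_integrable_def set_lebesgue_integral_def
    by (auto simp: has_bochner_integral_iff mult.commute)
qed

text \<open>\<open>tracking\<close> is the variation-of-constants solution of X' = (f - X) / a with
  X(0) = x. As f is merely integrable, the equation is verified in integrated form, by Fubini rather
  than by differentiation.\<close>

lemma tracking_integral_equation:
  fixes a x t :: real and f :: "real \<Rightarrow> real"
  assumes a: "0 < a" and t: "0 \<le> t" and [measurable]: "f \<in> borel_measurable borel"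
    and f: "set_integrable lborel {0..t} f"
  shows "set_integrable lborel {0..t} (tracking a x f)"
    and "x + (LBINT s:{0..t}. (f s - tracking a x f s) / a) = tracking a x f t"
proof -
  \<comment> \<open>The kernel on the triangle 0 \<le> r \<le> s \<le> t. Integrating out r leaves
    \<open>tracking\<close> without its initial term; integrating out s leaves f(r) times the kernel
    mass accumulated between r and t.\<close>
  define g where "g = (\<lambda>(s, r). indicator {0..t} s * (indicator {0..s} r * (exp (- (s - r) / a) / a * f r)) :: real)"
  have [measurable]: "g \<in> borel_measurable (lborel \<Otimes>\<^sub>M lborel)"
  proof -
    have "g = (\<lambda>(s, r). indicator {0..t} s * ((if 0 \<le> r \<and> r \<le> s then 1 else 0) * (exp (- (s - r) / a) / a * f r)))"
      unfolding g_def by (auto simp: indicator_def fun_eq_iff)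
    then show ?thesis by simp
  qed
  have f': "integrable lborel (\<lambda>r. indicator {0..t} r * \<bar>f r\<bar>)"
    using f unfolding set_integrable_def by (auto dest: integrable_abs simp: abs_mult)
  have f1: "integrable lborel (\<lambda>r. indicator {0..t} r * f r)"
    using f unfolding set_integrable_def by simp
  have gb: "\<bar>g (s, r)\<bar> \<le> indicator {0..t} s * (indicator {0..t} r * \<bar>f r\<bar> / a)" for s r
  proof -
    have "exp (- (s - r) / a) \<le> 1" if "r \<le> s"
      using a that by (simp add: divide_nonpos_pos)
    then show ?thesis
      using a by (auto simp: g_def indicator_def abs_mult intro!: mult_left_le_one_le divide_right_mono)
  qed
  have gb1: "integrable lborel (\<lambda>r. indicator {0..t} s * (indicator {0..t} r * \<bar>f r\<bar> / a))" for s
    using f' by simp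
  have gi: "integrable lborel (\<lambda>r. g (s, r))" for s
    by (rule Bochner_Integration.integrable_bound[OF gb1[of s]]) (use gb[of s] a in \<open>auto simp: abs_mult\<close>)
  have g_int: "integrable (lborel \<Otimes>\<^sub>M lborel) g"
  proof (rule lborel_pair.Fubini_integrable)
    have "norm (\<integral> r. norm (g (s, r)) \<partial>lborel) \<le> norm (indicator {0..t} s * ((\<integral>r. indicator {0..t} r * \<bar>f r\<bar> \<partial>lborel) / a))" for s
    proof -
      have "norm (\<integral> r. norm (g (s, r)) \<partial>lborel) = (\<integral> r. norm (g (s, r)) \<partial>lborel)"
        by simp
      also have "\<dots> \<le> (\<integral>r. indicator {0..t} s * (indicator {0..t} r * \<bar>f r\<bar> / a) \<partial>lborel)"
        using gb by (intro integral_mono gb1 integrable_norm gi) auto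
      finally show ?thesis using a by simp
    qed
    moreover have "integrable lborel (\<lambda>s. indicator {0..t} s * ((\<integral>r. indicator {0..t} r * \<bar>f r\<bar> \<partial>lborel) / a))"
      by (intro integrable_mult_left integrable_real_indicator) (use t in simp_all)
    ultimately show "integrable lborel (\<lambda>s. \<integral> r. norm (g (s, r)) \<partial>lborel)"
      by (rule Bochner_Integration.integrable_bound[rotated 2, OF AE_I2]) simp
  qed (use gi in auto)
  have inner1: "(\<integral>r. g (s, r) \<partial>lborel) = indicator {0..t} s * (tracking a x f s - exp (- s / a) * x)" for s
    by (simp add: g_def tracking_def set_lebesgue_integral_def)
  have inner2: "(\<integral>s. g (s, r) \<partial>lborel) = indicator {0..t} r * (f r * (1 - exp (- (t - r) / a)))" for r
  proof (cases "r \<in> {0..t}")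
    case True
    have "(\<integral>s. g (s, r) \<partial>lborel) = (\<integral>s. (indicator {r..t} s * (exp (- (s - r) / a) / a)) * f r \<partial>lborel)"
      by (rule Bochner_Integration.integral_cong) (use True in \<open>auto simp: g_def indicator_def\<close>)
    also have "\<dots> = (1 - exp (- (t - r) / a)) * f r"
      using LBINT_exp_decay(2)[OF a, of r t] True
      by (subst integral_mult_left_zero) (simp add: set_lebesgue_integral_def)
    finally show ?thesis using True by simp
  next
    case False
    then have "(\<lambda>s. g (s, r)) = (\<lambda>s. 0)" by (auto simp: g_def indicator_def fun_eq_iff)
    with False show ?thesis by simp
  qed
  have e1: "set_integrable lborel {0..t} (\<lambda>s. exp (- s / a) * x)"
    and e2: "(LBINT s:{0..t}. exp (- s / a) * x) = a * x * (1 - exp (- t / a))"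
  proof -
    note e = LBINT_exp_decay[OF a t]
    have "set_integrable lborel {0..t} (\<lambda>s. (a * x) * (exp (- (s - 0) / a) / a))"
      using e(1) by (rule set_integrable_mult_right)
    then show "set_integrable lborel {0..t} (\<lambda>s. exp (- s / a) * x)"
      using a by (simp add: mult.commute)
    have "(LBINT s:{0..t}. exp (- s / a) * x) = (LBINT s:{0..t}. (a * x) * (exp (- (s - 0) / a) / a))"
      using a by (simp add: mult.commute)
    also have "\<dots> = a * x * (1 - exp (- t / a))"
      using e(2) by (subst set_integral_mult_right) simp
    finally show "(LBINT s:{0..t}. exp (- s / a) * x) = a * x * (1 - exp (- t / a))" .
  qed
  have s1: "set_integrable lborel {0..t} (\<lambda>s. tracking a x f s - exp (- s / a) * x)"
    using lborel_pair.integrable_fst'[OF g_int] unfolding inner1 set_integrable_def by simp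
  from set_integral_add(1)[OF s1 e1]
  show tr: "set_integrable lborel {0..t} (tracking a x f)" by simp
  have x1: "integrable lborel (\<lambda>r. indicator {0..t} r * (f r * exp (- (t - r) / a)))"
    by (rule Bochner_Integration.integrable_bound[OF f1])
       (use a in \<open>auto simp: indicator_def abs_mult intro!: AE_I2 mult_left_le divide_nonpos_pos\<close>)
  have "(LBINT s:{0..t}. tracking a x f s) - (LBINT s:{0..t}. exp (- s / a) * x)
      = (\<integral>s. (\<integral>r. g (s, r) \<partial>lborel) \<partial>lborel)"
    unfolding inner1 by (subst set_integral_diff(2)[OF tr e1, symmetric]) (simp add: set_lebesgue_integral_def)
  also have "\<dots> = (\<integral>r. (\<integral>s. g (s, r) \<partial>lborel) \<partial>lborel)"
    by (rule lborel_pair.Fubini_integral[symmetric]) (use g_int in \<open>simp add: case_prod_eta\<close>)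
  also have "\<dots> = (\<integral>r. indicator {0..t} r * f r - indicator {0..t} r * (f r * exp (- (t - r) / a)) \<partial>lborel)"
    unfolding inner2 by (simp add: algebra_simps)
  also have "\<dots> = (LBINT r:{0..t}. f r) - (\<integral>r. a * (indicator {0..t} r * (exp (- (t - r) / a) / a * f r)) \<partial>lborel)"
    using a by (subst Bochner_Integration.integral_diff[OF f1 x1]) (simp add: set_lebesgue_integral_def mult_ac)
  also have "\<dots> = (LBINT r:{0..t}. f r) - a * (tracking a x f t - exp (- t / a) * x)"
    by (simp add: set_lebesgue_integral_def tracking_def)
  finally have "(LBINT s:{0..t}. tracking a x f s) = a * x + (LBINT r:{0..t}. f r) - a * tracking a x f t"
    unfolding e2 by (simp add: algebra_simps)
  then show "x + (LBINT s:{0..t}. (f s - tracking a x f s) / a) = tracking a x f t"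
    using a by (simp add: set_integral_diff(2)[OF f tr] field_simps)
qed

text \<open>Jensen's inequality for the square, from nonnegativity of the variance. In
  \<open>ennreal\<close> it needs no integrability hypothesis: if the square is not integrable, the
  right side is infinite.\<close>

lemma (in prob_space) square_integral_le:
  fixes f :: "'a \<Rightarrow> real"
  assumes [measurable]: "f \<in> borel_measurable M"
  shows "ennreal ((\<integral>x. f x \<partial>M)\<^sup>2) \<le> (\<integral>\<^sup>+x. ennreal ((f x)\<^sup>2) \<partial>M)"
proof (cases "integrable M (\<lambda>x. (f x)\<^sup>2)")
  case True
  then have "integrable M f"
    by (rule square_integrable_imp_integrable[rotated]) simp
  from variance_eq[OF this True] variance_positive[of f]
  have "(\<integral>x. f x \<partial>M)\<^sup>2 \<le> (\<integral>x. (f x)\<^sup>2 \<partial>M)" by simp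
  then show ?thesis using True
    by (subst nn_integral_eq_integral) (auto intro: ennreal_leI)
next
  case False
  then have "(\<integral>\<^sup>+x. ennreal ((f x)\<^sup>2) \<partial>M) = \<infinity>"
    by (auto simp: integrable_iff_bounded less_top[symmetric])
  then show ?thesis by simp
qed

text \<open>The kernel exp(-h/a)/a is an exponential density on the whole half line, but only lags h
  \<le> t reach back to times in [0, t]. The longer lags have total mass exp(-t/a);
  \<open>max (t - h) 0\<close> assigns them to f(0), and the first summand exchanges this f(0) for
  the initial value x. What remains is a mean of increments under a probability measure, the form
  that Jensen needs.\<close>

lemma tracking_error_representation:
  fixes a x t :: real and f :: "real \<Rightarrow> real"
  assumes a: "0 < a" and t: "0 \<le> t" and [measurable]: "f \<in> borel_measurable borel"
    and f: "set_integrable lborel {0..t} f"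
  defines "P \<equiv> density lborel (\<lambda>h. ennreal (exponential_density (1 / a) h))"
  shows "tracking a x f t - f t = exp (- t / a) * (x - f 0) + (\<integral>h. (f (max (t - h) 0) - f t) \<partial>P)"
proof -
  interpret P: prob_space P unfolding P_def using a by (intro prob_space_exponential_density) simp
  have sP[measurable_cong]: "sets P = sets borel" by (simp add: P_def)
  have e: "integrable lborel (\<lambda>s. indicator {0..t} s * (exp (- (t - s) / a) / a * f s))"
    by (rule Bochner_Integration.integrable_bound[where f="\<lambda>s. (indicator {0..t} s * f s) / a"])
       (use a f in \<open>auto simp: set_integrable_def indicator_def abs_mult intro!: AE_I2 mult_left_le_one_le divide_right_mono divide_nonpos_pos\<close>)
  have e': "integrable lborel (\<lambda>h. indicator {0..t} h * (exp (- h / a) / a * f (t - h)))"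
    and e'': "(\<integral>h. indicator {0..t} h * (exp (- h / a) / a * f (t - h)) \<partial>lborel) = (LBINT s:{0..t}. exp (- (t - s) / a) / a * f s)"
  proof -
    have eq: "(\<lambda>h. indicator {0..t} h * (exp (- h / a) / a * f (t - h))) =
      (\<lambda>h. indicator {0..t} (t + (-1) * h) * (exp (- (t - (t + (-1) * h)) / a) / a * f (t + (-1) * h)))"
      by (auto simp: fun_eq_iff indicator_def)
    show "integrable lborel (\<lambda>h. indicator {0..t} h * (exp (- h / a) / a * f (t - h)))"
      unfolding eq using lborel_integrable_real_affine[OF e, of "-1" t] by simp
    show "(\<integral>h. indicator {0..t} h * (exp (- h / a) / a * f (t - h)) \<partial>lborel) = (LBINT s:{0..t}. exp (- (t - s) / a) / a * f s)"
      unfolding eq set_lebesgue_integral_def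
      using lborel_integral_real_affine[of "-1" "\<lambda>s. indicator {0..t} s * (exp (- (t - s) / a) / a * f s)" t, symmetric] by simp
  qed
  have w: "integrable lborel (\<lambda>h. indicator {0..t} h * (exp (- h / a) / a * f 0))"
    and w': "(\<integral>h. indicator {0..t} h * (exp (- h / a) / a * f 0) \<partial>lborel) = (1 - exp (- t / a)) * f 0"
  proof -
    have eq: "(\<lambda>h. indicator {0..t} h * (exp (- h / a) / a * f 0)) = (\<lambda>h. (indicator {0..t} h * (exp (- (h - 0) / a) / a)) * f 0)"
      by (auto simp: fun_eq_iff)
    show "integrable lborel (\<lambda>h. indicator {0..t} h * (exp (- h / a) / a * f 0))"
      unfolding eq using LBINT_exp_decay(1)[OF a t] by (intro integrable_mult_left) (simp add: set_integrable_def)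
    show "(\<integral>h. indicator {0..t} h * (exp (- h / a) / a * f 0) \<partial>lborel) = (1 - exp (- t / a)) * f 0"
      unfolding eq using LBINT_exp_decay(2)[OF a t]
      by (subst integral_mult_left_zero) (simp add: set_lebesgue_integral_def)
  qed
  \<comment> \<open>Subtracting f(0) makes the integrand vanish for h > t, so that the integral over
    the half line reduces to the one over {0..t} in \<open>tracking\<close>.\<close>
  define q where "q = (\<lambda>h. f (max (t - h) 0) - f 0)"
  have [measurable]: "q \<in> borel_measurable borel" unfolding q_def by simp
  have qeq: "exponential_density (1 / a) h * q h =
     indicator {0..t} h * (exp (- h / a) / a * f (t - h)) - indicator {0..t} h * (exp (- h / a) / a * f 0)" for h
    using a by (auto simp: q_def exponential_density_def indicator_def max_def algebra_simps)
  have qi: "integrable P q"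
    unfolding P_def using a e' w
    by (subst integrable_density) (auto simp: exponential_density_nonneg qeq)
  have "(\<integral>h. q h \<partial>P) = (\<integral>h. exponential_density (1 / a) h * q h \<partial>lborel)"
    unfolding P_def using a by (subst integral_density) (auto simp: exponential_density_nonneg)
  then have qI: "(\<integral>h. q h \<partial>P) = (LBINT s:{0..t}. exp (- (t - s) / a) / a * f s) - (1 - exp (- t / a)) * f 0"
    by (simp only: qeq Bochner_Integration.integral_diff[OF e' w] e'' w')
  have "(\<integral>h. (f (max (t - h) 0) - f t) \<partial>P) = (\<integral>h. q h + (f 0 - f t) \<partial>P)"
    by (simp add: q_def)
  also have "\<dots> = (\<integral>h. q h \<partial>P) + (f 0 - f t)"
    using qi by (simp add: P.prob_space)
  finally show ?thesis unfolding qI tracking_def by (simp add: algebra_simps)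
qed

lemma square_add_le: "((u::real) + v)\<^sup>2 \<le> 2 * u\<^sup>2 + 2 * v\<^sup>2"
  using sum_squares_bound[of u v] by (simp add: power2_sum)

lemma tracking_error_square_le:
  fixes a x t :: real and f :: "real \<Rightarrow> real"
  assumes a: "0 < a" and t: "0 \<le> t" and [measurable]: "f \<in> borel_measurable borel"
    and f: "set_integrable lborel {0..t} f"
  shows "ennreal ((tracking a x f t - f t)\<^sup>2) \<le> ennreal (2 * exp (- (2 * t / a))) * ennreal ((x - f 0)\<^sup>2)
    + ennreal (2 / a) * (\<integral>\<^sup>+h\<in>{0<..}. (ennreal (exp (- h / a)) * ennreal (\<bar>f t - f (max (t - h) 0)\<bar>\<^sup>2)) \<partial>lborel)"
proof -
  define P where "P = density lborel (\<lambda>h. ennreal (exponential_density (1 / a) h))"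
  interpret P: prob_space P unfolding P_def using a by (intro prob_space_exponential_density) simp
  have sP[measurable_cong]: "sets P = sets borel" by (simp add: P_def)
  have "(tracking a x f t - f t)\<^sup>2 \<le> 2 * (exp (- t / a) * (x - f 0))\<^sup>2 + 2 * (\<integral>h. (f (max (t - h) 0) - f t) \<partial>P)\<^sup>2"
    unfolding tracking_error_representation[OF assms, folded P_def] by (rule square_add_le)
  also have "(exp (- t / a) * (x - f 0))\<^sup>2 = exp (- (2 * t / a)) * (x - f 0)\<^sup>2"
    by (simp add: power_mult_distrib exp_double[symmetric])
  finally have "ennreal ((tracking a x f t - f t)\<^sup>2) \<le> ennreal (2 * (exp (- (2 * t / a)) * (x - f 0)\<^sup>2) + 2 * (\<integral>h. (f (max (t - h) 0) - f t) \<partial>P)\<^sup>2)"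
    by (rule ennreal_leI)
  also have "\<dots> = ennreal (2 * exp (- (2 * t / a))) * ennreal ((x - f 0)\<^sup>2) + 2 * ennreal ((\<integral>h. (f (max (t - h) 0) - f t) \<partial>P)\<^sup>2)"
    by (simp add: ennreal_plus ennreal_mult mult.assoc)
  also have "\<dots> \<le> ennreal (2 * exp (- (2 * t / a))) * ennreal ((x - f 0)\<^sup>2) + 2 * (\<integral>\<^sup>+h. ennreal ((f (max (t - h) 0) - f t)\<^sup>2) \<partial>P)"
    by (intro add_left_mono mult_left_mono P.square_integral_le) auto
  also have "(\<integral>\<^sup>+h. ennreal ((f (max (t - h) 0) - f t)\<^sup>2) \<partial>P) =
      (\<integral>\<^sup>+h. ennreal (exponential_density (1 / a) h) * ennreal ((f (max (t - h) 0) - f t)\<^sup>2) \<partial>lborel)"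
    unfolding P_def by (subst nn_integral_density) auto
  also have "\<dots> = (\<integral>\<^sup>+h. ennreal (1 / a) * ((ennreal (exp (- h / a)) * ennreal (\<bar>f t - f (max (t - h) 0)\<bar>\<^sup>2)) * indicator {0<..} h) \<partial>lborel)"
    \<comment> \<open>The density is positive at h = 0, whereas the integral on the right runs over
      h > 0 only.\<close>
    by (rule nn_integral_cong_AE, use AE_lborel_singleton[of 0] in eventually_elim)
       (use a in \<open>auto simp: exponential_density_def indicator_def power2_commute ennreal_mult[symmetric] divide_simps\<close>)
  also have "\<dots> = ennreal (1 / a) * (\<integral>\<^sup>+h\<in>{0<..}. (ennreal (exp (- h / a)) * ennreal (\<bar>f t - f (max (t - h) 0)\<bar>\<^sup>2)) \<partial>lborel)"
    by (intro nn_integral_cmult) auto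
  also have "2 * (ennreal (1 / a) * (\<integral>\<^sup>+h\<in>{0<..}. (ennreal (exp (- h / a)) * ennreal (\<bar>f t - f (max (t - h) 0)\<bar>\<^sup>2)) \<partial>lborel))
     = ennreal (2 / a) * (\<integral>\<^sup>+h\<in>{0<..}. (ennreal (exp (- h / a)) * ennreal (\<bar>f t - f (max (t - h) 0)\<bar>\<^sup>2)) \<partial>lborel)"
    using a by (simp add: mult.assoc[symmetric] ennreal_mult'[symmetric] flip: ennreal_numeral)
  finally show ?thesis .
qed

text \<open>The pathwise origin of both coefficients of \<open>Omega_term\<close>: 2 exp(-2t/a)
  integrates over t to at most a, and 2/a is the factor 2 from squaring a sum times the density
  constant 1/a. Tonelli then moves the lag h outside.\<close>

lemma tracking_error_energy_le:
  fixes a x T :: real and f :: "real \<Rightarrow> real"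
  assumes a: "0 < a" and T: "0 \<le> T" and [measurable]: "f \<in> borel_measurable borel"
    and f: "set_integrable lborel {0..T} f"
  shows "(\<integral>\<^sup>+t\<in>{0..T}. ennreal ((tracking a x f t - f t)\<^sup>2) \<partial>lborel) \<le> ennreal a * ennreal ((x - f 0)\<^sup>2)
    + ennreal (2 / a) * (\<integral>\<^sup>+h\<in>{0<..}. (ennreal (exp (- h / a)) *
        (\<integral>\<^sup>+t\<in>{0..T}. ennreal (\<bar>f t - f (max (t - h) 0)\<bar>\<^sup>2) \<partial>lborel)) \<partial>lborel)"
proof -
  define g where "g = (\<lambda>t h. ennreal (exp (- h / a)) * ennreal (\<bar>f t - f (max (t - h) 0)\<bar>\<^sup>2))"
  have [measurable]: "(\<lambda>(t, h). g t h) \<in> borel_measurable (borel \<Otimes>\<^sub>M borel)"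
    unfolding g_def by measurable
  have gm1[measurable]: "(\<lambda>t. \<integral>\<^sup>+h. g t h * indicator {0<..} h \<partial>lborel) \<in> borel_measurable borel"
    by (rule lborel.borel_measurable_nn_integral) measurable
  have [measurable]: "(\<lambda>h. \<integral>\<^sup>+t. g t h * indicator {0..T} t \<partial>lborel) \<in> borel_measurable borel"
    by (rule lborel.borel_measurable_nn_integral) measurable
  have E: "(\<integral>\<^sup>+t\<in>{0..T}. ennreal (2 * exp (- (2 * t / a))) \<partial>lborel) \<le> ennreal a"
  proof -
    have "has_bochner_integral lborel (\<lambda>t. (2 * exp (- (2 * t / a))) * indicator {0..T} t)
       ((- a * exp (- (2 * T / a))) - (- a * exp (- (2 * 0 / a))))"
      using a T by (intro has_bochner_integral_FTC_Icc_real) (auto intro!: derivative_eq_intros continuous_intros)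
    then have "(\<integral>\<^sup>+t. ennreal ((2 * exp (- (2 * t / a))) * indicator {0..T} t) \<partial>lborel) = ennreal (a - a * exp (- (2 * T / a)))"
      by (subst nn_integral_eq_integral) (auto simp: has_bochner_integral_iff)
    also have "\<dots> \<le> ennreal a" using a by (intro ennreal_leI) simp
    finally show ?thesis by (simp add: ennreal_mult' ennreal_indicator)
  qed
  have "(\<integral>\<^sup>+t\<in>{0..T}. ennreal ((tracking a x f t - f t)\<^sup>2) \<partial>lborel)
     \<le> (\<integral>\<^sup>+t. ennreal (2 * exp (- (2 * t / a))) * indicator {0..T} t * ennreal ((x - f 0)\<^sup>2)
        + ennreal (2 / a) * ((\<integral>\<^sup>+h. g t h * indicator {0<..} h \<partial>lborel) * indicator {0..T} t) \<partial>lborel)"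
  proof (rule nn_integral_mono)
    fix t
    show "ennreal ((tracking a x f t - f t)\<^sup>2) * indicator {0..T} t
       \<le> ennreal (2 * exp (- (2 * t / a))) * indicator {0..T} t * ennreal ((x - f 0)\<^sup>2)
        + ennreal (2 / a) * ((\<integral>\<^sup>+h. g t h * indicator {0<..} h \<partial>lborel) * indicator {0..T} t)"
    proof (cases "t \<in> {0..T}")
      case True
      have "set_integrable lborel {0..t} f"
        by (rule set_integrable_subset[OF f]) (use True in auto)
      from tracking_error_square_le[OF a _ _ this, of x] True show ?thesis by (simp add: g_def)
    qed simp
  qed
  also have "\<dots> = (\<integral>\<^sup>+t\<in>{0..T}. ennreal (2 * exp (- (2 * t / a))) \<partial>lborel) * ennreal ((x - f 0)\<^sup>2)
     + ennreal (2 / a) * (\<integral>\<^sup>+t. (\<integral>\<^sup>+h. g t h * indicator {0<..} h \<partial>lborel) * indicator {0..T} t \<partial>lborel)"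
    by (subst nn_integral_add) (auto simp: nn_integral_cmult nn_integral_multc)
  also have "(\<integral>\<^sup>+t. (\<integral>\<^sup>+h. g t h * indicator {0<..} h \<partial>lborel) * indicator {0..T} t \<partial>lborel)
     = (\<integral>\<^sup>+t. (\<integral>\<^sup>+h. g t h * indicator {0<..} h * indicator {0..T} t \<partial>lborel) \<partial>lborel)"
    by (intro nn_integral_cong nn_integral_multc[symmetric]) measurable
  also have "\<dots> = (\<integral>\<^sup>+h. (\<integral>\<^sup>+t. g t h * indicator {0<..} h * indicator {0..T} t \<partial>lborel) \<partial>lborel)"
    by (rule lborel_pair.Fubini'[symmetric]) measurable
  also have "\<dots> = (\<integral>\<^sup>+h. (ennreal (exp (- h / a)) *
        (\<integral>\<^sup>+t\<in>{0..T}. ennreal (\<bar>f t - f (max (t - h) 0)\<bar>\<^sup>2) \<partial>lborel)) * indicator {0<..} h \<partial>lborel)"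
  proof (rule nn_integral_cong)
    fix h
    have "(\<integral>\<^sup>+t. g t h * indicator {0<..} h * indicator {0..T} t \<partial>lborel)
      = (\<integral>\<^sup>+t. (ennreal (exp (- h / a)) * indicator {0<..} h) * (ennreal (\<bar>f t - f (max (t - h) 0)\<bar>\<^sup>2) * indicator {0..T} t) \<partial>lborel)"
      by (simp add: g_def mult_ac)
    also have "\<dots> = (ennreal (exp (- h / a)) * indicator {0<..} h) * (\<integral>\<^sup>+t\<in>{0..T}. ennreal (\<bar>f t - f (max (t - h) 0)\<bar>\<^sup>2) \<partial>lborel)"
      by (rule nn_integral_cmult) measurable
    finally show "(\<integral>\<^sup>+t. g t h * indicator {0<..} h * indicator {0..T} t \<partial>lborel)
      = (ennreal (exp (- h / a)) * (\<integral>\<^sup>+t\<in>{0..T}. ennreal (\<bar>f t - f (max (t - h) 0)\<bar>\<^sup>2) \<partial>lborel)) * indicator {0<..} h"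
      by (simp add: mult_ac)
  qed
  finally show ?thesis
    by (rule order_trans) (intro add_right_mono mult_right_mono E, simp)
qed

lemma set_integrable_of_square:
  fixes f :: "real \<Rightarrow> real"
  assumes [measurable]: "f \<in> borel_measurable borel"
    and fin: "(\<integral>\<^sup>+t\<in>{b..c}. ennreal ((f t)\<^sup>2) \<partial>lborel) < \<infinity>"
  shows "set_integrable lborel {b..c} f"
proof -
  have "(\<integral>\<^sup>+t\<in>{b..c}. ennreal ((f t)\<^sup>2) \<partial>lborel) = (\<integral>\<^sup>+t. ennreal (indicator {b..c} t * (f t)\<^sup>2) \<partial>lborel)"
    by (intro nn_integral_cong) (auto simp: indicator_def)
  with fin have i2: "integrable lborel (\<lambda>t. indicator {b..c} t * (f t)\<^sup>2)"
    by (intro integrableI_nonneg) auto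
  have i1: "integrable lborel (\<lambda>t. indicator {b..c} t :: real)"
    by (intro integrable_real_indicator) (auto simp: emeasure_lborel_Icc_eq)
  have le: "\<bar>u\<bar> \<le> 1 + u\<^sup>2" for u :: real
    using sum_squares_bound[of "\<bar>u\<bar>" 1] by simp
  show ?thesis
    unfolding set_integrable_def
    by (rule Bochner_Integration.integrable_bound[OF Bochner_Integration.integrable_add[OF i1 i2]])
       (auto simp: indicator_def le intro!: AE_I2)
qed

text \<open>Instances of this serve as \<open>measurable (raw)\<close> rules, so that the
  measurability prover can handle processes whose two arguments both vary.\<close>

lemma jointly_measurable_compose:
  assumes "(\<lambda>p. f (fst p) (snd p)) \<in> borel_measurable (borel \<Otimes>\<^sub>M M)"
    "h \<in> borel_measurable N" "g \<in> measurable N M"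
  shows "(\<lambda>p. f (h p) (g p)) \<in> borel_measurable N"
  using measurable_compose[OF measurable_Pair[OF assms(2,3)] assms(1)] by simp

section \<open>The target martingale\<close>

definition square_integrable :: "'a measure \<Rightarrow> ('a \<Rightarrow> real) \<Rightarrow> bool" where
  "square_integrable M f \<longleftrightarrow> f \<in> borel_measurable M \<and> integrable M (\<lambda>\<omega>. (f \<omega>)\<^sup>2)"

lemma square_integrable_mult:
  assumes "square_integrable M f" "square_integrable M g"
  shows "integrable M (\<lambda>\<omega>. f \<omega> * g \<omega>)"
proof (rule Bochner_Integration.integrable_bound)
  show "integrable M (\<lambda>\<omega>. (f \<omega>)\<^sup>2 + (g \<omega>)\<^sup>2)"
    using assms by (auto simp: square_integrable_def)
  have "\<bar>u * v\<bar> \<le> u\<^sup>2 + v\<^sup>2" for u v :: real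
  proof -
    have "2 * \<bar>u * v\<bar> \<le> u\<^sup>2 + v\<^sup>2"
      using sum_squares_bound[of "\<bar>u\<bar>" "\<bar>v\<bar>"] by (simp add: abs_mult)
    then show ?thesis using abs_ge_zero[of "u * v"] by linarith
  qed
  then show "AE \<omega> in M. norm (f \<omega> * g \<omega>) \<le> norm ((f \<omega>)\<^sup>2 + (g \<omega>)\<^sup>2)"
    by auto
qed (use assms in \<open>auto simp: square_integrable_def\<close>)

lemma square_integrable_cmult:
  assumes "square_integrable M f"
  shows "square_integrable M (\<lambda>\<omega>. c * f \<omega>)"
  using assms by (auto simp: square_integrable_def power_mult_distrib)

lemma square_integrable_add:
  assumes "square_integrable M f" "square_integrable M g"
  shows "square_integrable M (\<lambda>\<omega>. f \<omega> + g \<omega>)"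
proof -
  have "integrable M (\<lambda>\<omega>. (f \<omega>)\<^sup>2 + (g \<omega>)\<^sup>2 + 2 * (f \<omega> * g \<omega>))"
    using assms square_integrable_mult[OF assms] by (auto simp: square_integrable_def)
  then have "integrable M (\<lambda>\<omega>. (f \<omega> + g \<omega>)\<^sup>2)"
    by (simp add: power2_sum mult.assoc)
  then show ?thesis
    using assms by (auto simp: square_integrable_def)
qed

lemma square_integrable_diff:
  assumes "square_integrable M f" "square_integrable M g"
  shows "square_integrable M (\<lambda>\<omega>. f \<omega> - g \<omega>)"
  using square_integrable_add[OF assms(1) square_integrable_cmult[OF assms(2), of "-1"]] by simp

lemma square_integrable_nn_integral:
  assumes "square_integrable M f"
  shows "(\<integral>\<^sup>+\<omega>. ennreal ((f \<omega>)\<^sup>2) \<partial>M) = ennreal (\<integral>\<omega>. (f \<omega>)\<^sup>2 \<partial>M)"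
  using assms by (intro nn_integral_eq_integral) (auto simp: square_integrable_def)

lemma square_integrable_iff:
  assumes "f \<in> borel_measurable M"
  shows "square_integrable M f \<longleftrightarrow> (\<integral>\<^sup>+\<omega>. ennreal ((f \<omega>)\<^sup>2) \<partial>M) < \<infinity>"
  using assms by (auto simp: square_integrable_def integrable_iff_bounded)

locale target_martingale = usual_filtered_prob_space M F T
  for M :: "'a measure" and F :: "real \<Rightarrow> 'a measure" and T :: real +
  fixes \<Xi>T :: "'a \<Rightarrow> real" and \<Xi> :: "real \<Rightarrow> 'a \<Rightarrow> real"
  assumes XiT_meas: "\<Xi>T \<in> borel_measurable (F T)"
    and XiT_L2: "integrable M (\<lambda>\<omega>. (\<Xi>T \<omega>)\<^sup>2)"
    and Xi: "cadlag_martingale_version M F T \<Xi>T \<Xi>"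
begin

lemma filtration_measurable:
  assumes "t \<in> {0..T}" "f \<in> borel_measurable (F t)"
  shows "f \<in> borel_measurable M"
  using measurable_from_subalg[OF subalg] assms by blast

lemma filtration_measurable_mono:
  assumes "0 \<le> s" "s \<le> t" "t \<le> T" "f \<in> borel_measurable (F s)"
  shows "f \<in> borel_measurable (F t)"
proof -
  have "subalgebra (F t) (F s)"
    using subalg[of s] subalg[of t] mono[of s t] assms by (auto simp: subalgebra_def)
  from measurable_from_subalg[OF this assms(4)] show ?thesis .
qed

lemma XiT_square_integrable: "square_integrable M \<Xi>T"
  using filtration_measurable[OF _ XiT_meas] XiT_L2 T_pos by (auto simp: square_integrable_def)

lemma Xi_measurable: "t \<in> {0..T} \<Longrightarrow> \<Xi> t \<in> borel_measurable (F t)"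
  and Xi_cond_exp: "t \<in> {0..T} \<Longrightarrow> AE \<omega> in M. \<Xi> t \<omega> = real_cond_exp M (F t) \<Xi>T \<omega>"
  using Xi by (auto simp: cadlag_martingale_version_def)

lemma sigma_finite_subalgebra_F: "t \<in> {0..T} \<Longrightarrow> sigma_finite_subalgebra M (F t)"
proof -
  assume "t \<in> {0..T}"
  then interpret finite_measure_subalgebra M "F t"
    by unfold_locales (rule subalg)
  show ?thesis by unfold_locales
qed

lemma XiT_integrable: "integrable M \<Xi>T"
  using XiT_square_integrable square_integrable_imp_integrable by (auto simp: square_integrable_def)

text \<open>Conditional Jensen for the square.\<close>

lemma Xi_square_integrable:
  assumes t: "t \<in> {0..T}"
  shows "square_integrable M (\<Xi> t)"
proof -
  interpret S: sigma_finite_subalgebra M "F t" using t by (rule sigma_finite_subalgebra_F)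
  have m[measurable]: "\<Xi> t \<in> borel_measurable M"
    using filtration_measurable[OF t Xi_measurable[OF t]] .
  have "integrable M (\<lambda>\<omega>. (real_cond_exp M (F t) \<Xi>T \<omega>)\<^sup>2)"
    by (rule S.integrable_convex_cond_exp[where I=UNIV and q="\<lambda>u. u\<^sup>2"])
       (use XiT_integrable XiT_L2 in \<open>auto intro: convex_power2\<close>)
  then have "integrable M (\<lambda>\<omega>. (\<Xi> t \<omega>)\<^sup>2)"
    by (rule integrable_cong_AE_imp) (use Xi_cond_exp[OF t] in auto)
  then show ?thesis using m by (simp add: square_integrable_def)
qed

text \<open>Conditional expectation as the orthogonal projection onto the square integrable
  functions measurable for \<open>F t\<close>. The orthogonality of martingale increments below
  comes from this alone.\<close>

lemma Xi_projection:
  assumes t: "t \<in> {0..T}" and Z: "Z \<in> borel_measurable (F t)" "square_integrable M Z"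
  shows "(\<integral>\<omega>. \<Xi> t \<omega> * Z \<omega> \<partial>M) = (\<integral>\<omega>. \<Xi>T \<omega> * Z \<omega> \<partial>M)"
proof -
  interpret S: sigma_finite_subalgebra M "F t" using t by (rule sigma_finite_subalgebra_F)
  have [measurable]: "Z \<in> borel_measurable M" "\<Xi>T \<in> borel_measurable M" "\<Xi> t \<in> borel_measurable M"
    using Z XiT_square_integrable Xi_square_integrable[OF t] by (auto simp: square_integrable_def)
  have "(\<integral>\<omega>. Z \<omega> * real_cond_exp M (F t) \<Xi>T \<omega> \<partial>M) = (\<integral>\<omega>. Z \<omega> * \<Xi>T \<omega> \<partial>M)"
    by (rule S.real_cond_exp_intg(2)) (use Z XiT_square_integrable in \<open>auto intro!: square_integrable_mult\<close>)
  moreover have "(\<integral>\<omega>. \<Xi> t \<omega> * Z \<omega> \<partial>M) = (\<integral>\<omega>. Z \<omega> * real_cond_exp M (F t) \<Xi>T \<omega> \<partial>M)"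
    by (rule integral_cong_AE) (use Xi_cond_exp[OF t] in auto)
  ultimately show ?thesis by (simp add: mult.commute)
qed

lemma Xi_terminal: "AE \<omega> in M. \<Xi> T \<omega> = \<Xi>T \<omega>"
proof -
  have T: "T \<in> {0..T}" using T_pos by simp
  interpret S: sigma_finite_subalgebra M "F T" using T by (rule sigma_finite_subalgebra_F)
  show ?thesis
    using Xi_cond_exp[OF T] S.real_cond_exp_F_meas[OF XiT_integrable XiT_meas] by auto
qed

text \<open>The function \<Xi>(s) - Z is measurable for \<open>F s\<close>, hence for
  \<open>F t\<close>, so its pairings with \<Xi>(s) and with \<Xi>(t) both equal the one with
  \<open>\<Xi>T\<close>; the increment is therefore orthogonal to it. Z = 0 turns increments into
  differences of second moments, and Z a point of the bridge separates the new information from the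
  error already known.\<close>

lemma Xi_pythagoras:
  assumes "0 \<le> s" "s \<le> t" "t \<le> T" and Z: "Z \<in> borel_measurable (F s)" "square_integrable M Z"
  shows "(\<integral>\<omega>. (\<Xi> t \<omega> - Z \<omega>)\<^sup>2 \<partial>M) = (\<integral>\<omega>. (\<Xi> t \<omega> - \<Xi> s \<omega>)\<^sup>2 \<partial>M) + (\<integral>\<omega>. (\<Xi> s \<omega> - Z \<omega>)\<^sup>2 \<partial>M)"
proof -
  have s: "s \<in> {0..T}" and t: "t \<in> {0..T}" using assms by auto
  note sq = Xi_square_integrable[OF s] Xi_square_integrable[OF t]
  define W where "W = (\<lambda>\<omega>. \<Xi> s \<omega> - Z \<omega>)"
  have Ws: "W \<in> borel_measurable (F s)"
    unfolding W_def using Z(1) Xi_measurable[OF s] by simp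
  have Wt: "W \<in> borel_measurable (F t)"
    using filtration_measurable_mono[OF assms(1-3) Ws] .
  have W2: "square_integrable M W"
    unfolding W_def by (intro square_integrable_diff sq Z(2))
  have D2: "square_integrable M (\<lambda>\<omega>. \<Xi> t \<omega> - \<Xi> s \<omega>)"
    by (intro square_integrable_diff sq)
  have "(\<integral>\<omega>. (\<Xi> t \<omega> - \<Xi> s \<omega>) * W \<omega> \<partial>M) = (\<integral>\<omega>. \<Xi> t \<omega> * W \<omega> \<partial>M) - (\<integral>\<omega>. \<Xi> s \<omega> * W \<omega> \<partial>M)"
    by (subst Bochner_Integration.integral_diff[symmetric])
       (auto intro!: square_integrable_mult sq W2 simp: algebra_simps)
  also have "\<dots> = 0"
    using Xi_projection[OF s Ws W2] Xi_projection[OF t Wt W2] by simp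
  finally have orth: "(\<integral>\<omega>. (\<Xi> t \<omega> - \<Xi> s \<omega>) * W \<omega> \<partial>M) = 0" .
  have "(\<integral>\<omega>. (\<Xi> t \<omega> - Z \<omega>)\<^sup>2 \<partial>M) = (\<integral>\<omega>. ((\<Xi> t \<omega> - \<Xi> s \<omega>)\<^sup>2 + (W \<omega>)\<^sup>2) + 2 * ((\<Xi> t \<omega> - \<Xi> s \<omega>) * W \<omega>) \<partial>M)"
    unfolding W_def by (intro Bochner_Integration.integral_cong) (auto simp: power2_eq_square algebra_simps)
  also have "\<dots> = (\<integral>\<omega>. (\<Xi> t \<omega> - \<Xi> s \<omega>)\<^sup>2 \<partial>M) + (\<integral>\<omega>. (W \<omega>)\<^sup>2 \<partial>M) + 2 * (\<integral>\<omega>. (\<Xi> t \<omega> - \<Xi> s \<omega>) * W \<omega> \<partial>M)"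
    using D2 W2 square_integrable_mult[OF D2 W2] by (simp add: square_integrable_def)
  finally show ?thesis unfolding orth by (simp add: W_def)
qed

text \<open>Processes carry information only on [0, T]. Freezing them at the endpoints gives
  functions on the whole line, for which joint measurability can be stated, and agrees with the
  extension chosen in \<open>second_moment_measure\<close>.\<close>

definition clamp_time :: "real \<Rightarrow> real" where
  "clamp_time t = max 0 (min t T)"

lemma clamp_time_mem [simp]: "clamp_time t \<in> {0..T}" "0 \<le> clamp_time t" "clamp_time t \<le> T"
  using T_pos by (auto simp: clamp_time_def)

lemma clamp_time_id: "0 \<le> t \<Longrightarrow> t \<le> T \<Longrightarrow> clamp_time t = t"
  by (auto simp: clamp_time_def)

lemma clamp_time_mono: "s \<le> t \<Longrightarrow> clamp_time s \<le> clamp_time t"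
  by (auto simp: clamp_time_def)

lemma clamp_time_measurable [measurable]: "clamp_time \<in> borel_measurable borel"
  unfolding clamp_time_def by measurable

section \<open>The second moment of the target and its Stieltjes measure\<close>

definition second_moment :: "real \<Rightarrow> real" where
  "second_moment t = (\<integral>\<omega>. (\<Xi> (clamp_time t) \<omega>)\<^sup>2 \<partial>M)"

lemma Xi_increment:
  assumes "0 \<le> s" "s \<le> t" "t \<le> T"
  shows "(\<integral>\<omega>. (\<Xi> t \<omega> - \<Xi> s \<omega>)\<^sup>2 \<partial>M) = second_moment t - second_moment s"
  using Xi_pythagoras[OF assms, of "\<lambda>_. 0"] assms
  by (simp add: second_moment_def clamp_time_id square_integrable_def)

lemma second_moment_mono: "s \<le> t \<Longrightarrow> second_moment s \<le> second_moment t"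
proof -
  assume "s \<le> t"
  then have "(\<integral>\<omega>. (\<Xi> (clamp_time t) \<omega> - \<Xi> (clamp_time s) \<omega>)\<^sup>2 \<partial>M)
     = second_moment (clamp_time t) - second_moment (clamp_time s)"
    by (intro Xi_increment clamp_time_mono) auto
  moreover have "0 \<le> (\<integral>\<omega>. (\<Xi> (clamp_time t) \<omega> - \<Xi> (clamp_time s) \<omega>)\<^sup>2 \<partial>M)"
    by (intro integral_nonneg_AE) auto
  ultimately show ?thesis
    by (simp add: second_moment_def clamp_time_id)
qed

lemma Xi_right_continuous:
  assumes "\<omega> \<in> space M"
  shows "((\<lambda>s. \<Xi> (clamp_time s) \<omega>) \<longlongrightarrow> \<Xi> (clamp_time t) \<omega>) (at_right t)"
proof -
  consider "t < 0" | "T \<le> t" | "0 \<le> t" "t < T" by linarith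
  then show ?thesis
  proof cases
    case 1
    have "eventually (\<lambda>s. s < 0) (at_right t)"
      by (rule order_tendstoD(2)[OF tendsto_ident_at 1])
    then have "eventually (\<lambda>s. \<Xi> (clamp_time s) \<omega> = \<Xi> (clamp_time t) \<omega>) (at_right t)"
      by eventually_elim (use 1 T_pos in \<open>auto simp: clamp_time_def min_def\<close>)
    then show ?thesis by (rule tendsto_eventually)
  next
    case 2
    have "eventually (\<lambda>s. s > t) (at_right t)"
      by (rule eventually_at_right_less)
    then have "eventually (\<lambda>s. \<Xi> (clamp_time s) \<omega> = \<Xi> (clamp_time t) \<omega>) (at_right t)"
      by eventually_elim (use 2 T_pos in \<open>auto simp: clamp_time_def min_def\<close>)
    then show ?thesis by (rule tendsto_eventually)
  next
    case 3
    have "continuous (at_right t) (\<lambda>s. \<Xi> s \<omega>)"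
      using Xi assms 3 by (auto simp: cadlag_martingale_version_def cadlag_on_def)
    then have *: "((\<lambda>s. \<Xi> s \<omega>) \<longlongrightarrow> \<Xi> t \<omega>) (at_right t)"
      by (simp add: continuous_within)
    have "eventually (\<lambda>s. t < s \<and> s < T) (at_right t)"
      by (intro eventually_conj eventually_at_right_less order_tendstoD(2)[OF tendsto_ident_at 3(2)])
    then have "eventually (\<lambda>s. \<Xi> s \<omega> = \<Xi> (clamp_time s) \<omega>) (at_right t)"
      by eventually_elim (use 3 in \<open>auto simp: clamp_time_id\<close>)
    from Lim_transform_eventually[OF * this] 3 show ?thesis by (simp add: clamp_time_id)
  qed
qed

text \<open>Uniform integrability is replaced by the elementary splitting
  \<open>\<bar>D Z\<bar> \<le> \<epsilon> D\<^sup>2 + min \<bar>D Z\<bar> (Z\<^sup>2 / \<epsilon>)\<close>, whose last term is dominated.\<close>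

lemma second_moment_right_continuous: "continuous (at_right t) second_moment"
proof -
  have "(second_moment \<longlongrightarrow> second_moment t) (at_right t)"
  proof (rule tendsto_at_right_sequentially[of t "t + 1"])
    fix S :: "nat \<Rightarrow> real"
    assume S: "\<And>n. t < S n" "\<And>n. S n < t + 1" "decseq S" "S \<longlonglongrightarrow> t"
    define N where "N = (\<lambda>s. \<Xi> (clamp_time s))"
    define D where "D = (\<lambda>n \<omega>. N (S n) \<omega> - N t \<omega>)"
    have N2: "square_integrable M (N s)" for s
      unfolding N_def by (intro Xi_square_integrable) simp
    have D2: "square_integrable M (D n)" for n
      unfolding D_def by (intro square_integrable_diff N2)
    have [measurable]: "D n \<in> borel_measurable M" "\<Xi>T \<in> borel_measurable M" for n
      using D2[of n] XiT_square_integrable by (auto simp: square_integrable_def)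
    \<comment> \<open>By projection, the second moment is the pairing of \<Xi>(s) with
      \<open>\<Xi>T\<close>. Differences of second moments thus become linear in \<open>D n\<close>,
      so pointwise convergence of \<open>D n\<close> and a uniform bound on its second moment
      suffice.\<close>
    have moment: "second_moment s = (\<integral>\<omega>. \<Xi>T \<omega> * N s \<omega> \<partial>M)" for s
      using Xi_projection[of "clamp_time s" "N s"] N2[of s] Xi_measurable[of "clamp_time s"]
      by (simp add: second_moment_def N_def power2_eq_square)
    have diff: "second_moment (S n) - second_moment t = (\<integral>\<omega>. \<Xi>T \<omega> * D n \<omega> \<partial>M)" for n
      unfolding moment D_def
      by (subst Bochner_Integration.integral_diff[symmetric])
         (auto intro!: square_integrable_mult XiT_square_integrable N2 simp: algebra_simps)
    define C where "C = second_moment T"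
    have C0: "0 \<le> C" by (simp add: C_def second_moment_def)
    have DC: "(\<integral>\<omega>. (D n \<omega>)\<^sup>2 \<partial>M) \<le> C" for n
    proof -
      have "(\<integral>\<omega>. (D n \<omega>)\<^sup>2 \<partial>M) = second_moment (clamp_time (S n)) - second_moment (clamp_time t)"
        unfolding D_def N_def using S(1)[of n] by (intro Xi_increment clamp_time_mono) auto
      also have "\<dots> \<le> second_moment (clamp_time (S n))"
        by (simp add: second_moment_def)
      also have "\<dots> \<le> C" unfolding C_def by (intro second_moment_mono) simp
      finally show ?thesis .
    qed
    have Dlim: "(\<lambda>n. D n \<omega>) \<longlonglongrightarrow> 0" if "\<omega> \<in> space M" for \<omega>
    proof -
      have "filterlim S (at_right t) sequentially"
        using S by (intro filterlim_at_withinI) auto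
      from filterlim_compose[OF Xi_right_continuous[OF that, of t] this]
      show ?thesis unfolding D_def N_def by (simp add: LIM_zero_iff)
    qed
    show "(\<lambda>n. second_moment (S n)) \<longlonglongrightarrow> second_moment t"
    proof (rule LIMSEQ_I)
      fix r :: real assume r: "0 < r"
      \<comment> \<open>The uniform bound C makes the first part of the splitting at most r/2; C + 1
        avoids a zero denominator.\<close>
      define e where "e = r / (2 * (C + 1))"
      have e: "0 < e" and eC: "e * C \<le> r / 2"
        using r C0 by (auto simp: e_def field_simps)
      define g where "g = (\<lambda>n \<omega>. min \<bar>\<Xi>T \<omega> * D n \<omega>\<bar> ((\<Xi>T \<omega>)\<^sup>2 / e))"
      have [measurable]: "g n \<in> borel_measurable M" for n unfolding g_def by measurable
      have w: "integrable M (\<lambda>\<omega>. (\<Xi>T \<omega>)\<^sup>2 / e)" using XiT_L2 by simp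
      have gl: "\<omega> \<in> space M \<Longrightarrow> (\<lambda>n. g n \<omega>) \<longlonglongrightarrow> 0" for \<omega>
      proof -
        assume "\<omega> \<in> space M"
        then have "(\<lambda>n. min \<bar>\<Xi>T \<omega> * D n \<omega>\<bar> ((\<Xi>T \<omega>)\<^sup>2 / e)) \<longlonglongrightarrow> min \<bar>\<Xi>T \<omega> * 0\<bar> ((\<Xi>T \<omega>)\<^sup>2 / e)"
          by (intro tendsto_intros Dlim)
        then show ?thesis using e by (simp add: g_def)
      qed
      have gb: "AE \<omega> in M. norm (g n \<omega>) \<le> (\<Xi>T \<omega>)\<^sup>2 / e" for n
        using e by (auto simp: g_def)
      have gi: "integrable M (g n)" for n
        by (rule Bochner_Integration.integrable_bound[OF w]) (use gb[of n] e in auto)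
      have "(\<lambda>n. \<integral>\<omega>. g n \<omega> \<partial>M) \<longlonglongrightarrow> (\<integral>\<omega>. 0 \<partial>M)"
        by (rule integral_dominated_convergence[OF _ _ w]) (use gl gb in auto)
      then obtain n0 where n0: "\<And>n. n \<ge> n0 \<Longrightarrow> \<bar>\<integral>\<omega>. g n \<omega> \<partial>M\<bar> < r / 2"
        using LIMSEQ_D[of _ 0 "r / 2"] r by fastforce
      have split: "\<bar>z * d\<bar> \<le> e * d\<^sup>2 + min \<bar>z * d\<bar> (z\<^sup>2 / e)" for z d :: real
      proof (cases "\<bar>z * d\<bar> \<le> z\<^sup>2 / e")
        case False
        then have "e * (\<bar>z\<bar> * \<bar>d\<bar>) > \<bar>z\<bar> * \<bar>z\<bar>"
          using e by (simp add: field_simps abs_mult power2_eq_square)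
        then have "\<bar>z\<bar> * \<bar>z\<bar> < \<bar>z\<bar> * (e * \<bar>d\<bar>)"
          by (simp add: mult_ac)
        then have "\<bar>z\<bar> \<le> e * \<bar>d\<bar>"
          by (smt (verit) abs_ge_zero mult_left_mono)
        then have "\<bar>z\<bar> * \<bar>d\<bar> \<le> e * \<bar>d\<bar> * \<bar>d\<bar>" by (rule mult_right_mono) simp
        then have "\<bar>z * d\<bar> \<le> e * d\<^sup>2" by (simp add: abs_mult power2_eq_square)
        moreover have "0 \<le> min \<bar>z * d\<bar> (z\<^sup>2 / e)" using e by simp
        ultimately show ?thesis by linarith
      qed (use e in simp)
      show "\<exists>n0. \<forall>n\<ge>n0. norm (second_moment (S n) - second_moment t) < r"
      proof (intro exI[of _ n0] allI impI)
        fix n assume n: "n0 \<le> n"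
        have D2': "integrable M (\<lambda>\<omega>. e * (D n \<omega>)\<^sup>2)" using D2[of n] by (simp add: square_integrable_def)
        have "norm (second_moment (S n) - second_moment t) \<le> (\<integral>\<omega>. \<bar>\<Xi>T \<omega> * D n \<omega>\<bar> \<partial>M)"
          unfolding diff using integral_norm_bound[of M "\<lambda>\<omega>. \<Xi>T \<omega> * D n \<omega>"] by simp
        also have "\<dots> \<le> (\<integral>\<omega>. e * (D n \<omega>)\<^sup>2 + g n \<omega> \<partial>M)"
          by (intro integral_mono integrable_abs square_integrable_mult XiT_square_integrable D2
                Bochner_Integration.integrable_add D2' gi) (auto simp: g_def split)
        also have "\<dots> = e * (\<integral>\<omega>. (D n \<omega>)\<^sup>2 \<partial>M) + (\<integral>\<omega>. g n \<omega> \<partial>M)"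
          using D2' gi[of n] by simp
        also have "\<dots> < r / 2 + r / 2"
          using n0[OF n] mult_left_mono[OF DC[of n], of e] e eC by linarith
        finally show "norm (second_moment (S n) - second_moment t) < r" by simp
      qed
    qed
  qed simp
  then show ?thesis by (simp add: continuous_within)
qed

text \<open>The rule for \<open>interval_measure\<close> asks for a monotone, right-continuous
  integrator. Monotonicity comes from orthogonality of increments, right continuity from the cadlag
  paths of \<open>\<Xi>\<close>.\<close>

lemma emeasure_second_moment_measure:
  "s \<le> t \<Longrightarrow> emeasure (second_moment_measure M T \<Xi>) {s<..t} = ennreal (second_moment t - second_moment s)"
proof -
  assume "s \<le> t"
  moreover have "second_moment_measure M T \<Xi> = interval_measure second_moment"
    by (simp add: second_moment_measure_def second_moment_def[abs_def] clamp_time_def)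
  ultimately show ?thesis
    using emeasure_interval_measure_Ioc[OF _ second_moment_mono second_moment_right_continuous] by simp
qed

definition reach_increment :: "real \<Rightarrow> real \<Rightarrow> ennreal" where
  "reach_increment s t = (\<integral>\<^sup>+r\<in>{s<..t}. (1 / ennreal (T - r)) \<partial>second_moment_measure M T \<Xi>)"

lemma sets_second_moment_measure [measurable_cong]: "sets (second_moment_measure M T \<Xi>) = sets borel"
  by (simp add: second_moment_measure_def)

text \<open>On (s, t] the weight 1/(T - r) is at least 1/(T - s), so the mass of the interval is
  dominated by T - s times its weighted mass.\<close>

lemma second_moment_increment_le:
  assumes "s \<le> t" "t \<le> T"
  shows "ennreal (second_moment t - second_moment s) \<le> ennreal (T - s) * reach_increment s t"
proof -
  have "ennreal (second_moment t - second_moment s) = (\<integral>\<^sup>+r. indicator {s<..t} r \<partial>second_moment_measure M T \<Xi>)"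
    using emeasure_second_moment_measure[OF assms(1)]
    by (subst nn_integral_indicator) (auto simp: sets_second_moment_measure)
  also have "\<dots> \<le> (\<integral>\<^sup>+r. ennreal (T - s) * ((1 / ennreal (T - r)) * indicator {s<..t} r) \<partial>second_moment_measure M T \<Xi>)"
  proof (rule nn_integral_mono)
    fix r
    show "indicator {s<..t} r \<le> ennreal (T - s) * ((1 / ennreal (T - r)) * indicator {s<..t} r)"
    proof (cases "r \<in> {s<..t}")
      case True
      have "1 \<le> ennreal (T - s) * (1 / ennreal (T - r))"
      \<comment> \<open>At r = T the weight is 1/0 = \<infinity> while T - s > 0, so the product is
        \<infinity> and the inequality survives a possible atom at T.\<close>
      proof (cases "r = T")
        case True
        with \<open>r \<in> {s<..t}\<close> show ?thesis by (simp add: ennreal_mult_top divide_ennreal_def ennreal_eq_0_iff)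
      next
        case False
        with \<open>r \<in> {s<..t}\<close> assms have "r < T" "s < r" by auto
        then have "ennreal (T - s) * (1 / ennreal (T - r)) = ennreal ((T - s) / (T - r))"
          by (simp add: divide_ennreal ennreal_mult[symmetric] flip: ennreal_1)
        moreover have "1 \<le> (T - s) / (T - r)" using \<open>r < T\<close> \<open>s < r\<close> by simp
        ultimately show ?thesis by simp
      qed
      with True show ?thesis by simp
    qed simp
  qed
  also have "\<dots> = ennreal (T - s) * reach_increment s t"
    unfolding reach_increment_def by (rule nn_integral_cmult) measurable
  finally show ?thesis .
qed

lemma suminf_reach_increment_le:
  assumes "incseq p" "s \<le> p 0" "\<And>k. p k \<le> T"
  shows "(\<Sum>k. reach_increment (p k) (p (Suc k))) \<le> reach_integral M T \<Xi> s"
proof -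
  have dis: "disjoint_family (\<lambda>k. {p k<..p (Suc k)})"
    unfolding disjoint_family_on_def
  proof (intro ballI impI)
    fix i j :: nat assume "i \<noteq> j"
    then have "Suc i \<le> j \<or> Suc j \<le> i" by linarith
    then have "p (Suc i) \<le> p j \<or> p (Suc j) \<le> p i" using incseqD[OF assms(1)] by metis
    then show "{p i<..p (Suc i)} \<inter> {p j<..p (Suc j)} = {}" by auto
  qed
  have sub: "(\<Union>k. {p k<..p (Suc k)}) \<subseteq> {s<..T}"
  proof (rule UN_least)
    fix k
    show "{p k<..p (Suc k)} \<subseteq> {s<..T}"
      using assms(2) assms(3)[of "Suc k"] incseqD[OF assms(1), of 0 k] by auto
  qed
  have "(\<Sum>k. reach_increment (p k) (p (Suc k)))
     = (\<integral>\<^sup>+r. (\<Sum>k. (1 / ennreal (T - r)) * indicator {p k<..p (Suc k)} r) \<partial>second_moment_measure M T \<Xi>)"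
    unfolding reach_increment_def by (rule nn_integral_suminf[symmetric]) measurable
  also have "\<dots> \<le> reach_integral M T \<Xi> s"
    unfolding reach_integral_def
  proof (rule nn_integral_mono)
    fix r
    have "(\<Sum>k. (1 / ennreal (T - r)) * indicator {p k<..p (Suc k)} r) = (1 / ennreal (T - r)) * indicator (\<Union>k. {p k<..p (Suc k)}) r"
      using suminf_indicator[OF dis] by simp
    also have "\<dots> \<le> (1 / ennreal (T - r)) * indicator {s<..T} r"
      using subsetD[OF sub, of r] by (intro mult_left_mono indicator_leI) simp_all
    finally show "(\<Sum>k. (1 / ennreal (T - r)) * indicator {p k<..p (Suc k)} r) \<le> (1 / ennreal (T - r)) * indicator {s<..T} r" .
  qed
  finally show ?thesis .
qed

end

section \<open>Joint measurability of the processes\<close>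

context target_martingale
begin

lemma identity_measurable_F: "t \<in> {0..T} \<Longrightarrow> (\<lambda>\<omega>. \<omega>) \<in> measurable M (F t)"
  using subalg[of t] by (auto simp: subalgebra_def measurable_def)

text \<open>Truncating time at t lets the time variable range over the whole line while the
  randomness stays in \<open>F t\<close>; this trades the restricted space in
  \<open>progressive\<close> for a plain product.\<close>

lemma progressive_stopped_measurable:
  assumes "progressive F T u" "t \<in> {0..T}"
  shows "(\<lambda>(s, \<omega>). u (max 0 (min s t)) \<omega>) \<in> borel_measurable (borel \<Otimes>\<^sub>M F t)"
proof -
  have 1: "(\<lambda>(s, \<omega>). u s \<omega>) \<in> borel_measurable (restrict_space borel {0..t} \<Otimes>\<^sub>M F t)"
    using assms by (auto simp: progressive_def)
  have 2: "(\<lambda>p. (max 0 (min (fst p) t), snd p)) \<in> measurable (borel \<Otimes>\<^sub>M F t) (restrict_space borel {0..t} \<Otimes>\<^sub>M F t)"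
    by (intro measurable_Pair measurable_restrict_space2) (use assms(2) in auto)
  from measurable_compose[OF 2 1] show ?thesis by (simp add: case_prod_beta)
qed

lemma progressive_section:
  assumes "progressive F T u" "t \<in> {0..T}"
  shows "u t \<in> borel_measurable (F t)"
proof -
  have "(\<lambda>\<omega>. (t, \<omega>)) \<in> measurable (F t) (borel \<Otimes>\<^sub>M F t)" by simp
  from measurable_compose[OF this progressive_stopped_measurable[OF assms]] assms(2)
  show ?thesis by simp
qed

lemma progressive_jointly_measurable:
  assumes "progressive F T u"
  shows "(\<lambda>(s, \<omega>). u (clamp_time s) \<omega>) \<in> borel_measurable (borel \<Otimes>\<^sub>M M)"
proof -
  have T: "T \<in> {0..T}" using T_pos by simp
  have "(\<lambda>p. (fst p, snd p)) \<in> measurable (borel \<Otimes>\<^sub>M M) (borel \<Otimes>\<^sub>M F T)"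
    by (intro measurable_Pair measurable_fst measurable_compose[OF measurable_snd identity_measurable_F[OF T]])
  from measurable_compose[OF this progressive_stopped_measurable[OF assms T]]
  show ?thesis by (simp add: case_prod_beta clamp_time_def)
qed

text \<open>Right-continuity exhibits the process as the limit of its values on the grid \<open>(\<lfloor>s n\<rfloor> + 1) / n\<close>,
  which lies strictly to the right of \<open>s\<close>.\<close>

lemma Xi_jointly_measurable:
  "(\<lambda>(s, \<omega>). \<Xi> (clamp_time s) \<omega>) \<in> borel_measurable (borel \<Otimes>\<^sub>M M)"
proof -
  define grid where "grid = (\<lambda>n s. (of_int \<lfloor>s * real (Suc n)\<rfloor> + 1) / real (Suc n))"
  have [measurable]: "\<Xi> (clamp_time s) \<in> borel_measurable M" for s
    using filtration_measurable[OF _ Xi_measurable] by simp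
  have m: "(\<lambda>p. \<Xi> (clamp_time (grid n (fst p))) (snd p)) \<in> borel_measurable (borel \<Otimes>\<^sub>M M)" for n
    unfolding grid_def
    by (rule measurable_compose_countable[where f="\<lambda>i p. \<Xi> (clamp_time ((of_int i + 1) / real (Suc n))) (snd p)"
          and g="\<lambda>p. \<lfloor>fst p * real (Suc n)\<rfloor>"]) measurable
  have grid: "filterlim (\<lambda>n. grid n s) (at_right s) sequentially" for s
  proof (rule filterlim_at_withinI)
    have lower: "s < grid n s" for n
    proof -
      have "s * real (Suc n) < of_int \<lfloor>s * real (Suc n)\<rfloor> + 1" by linarith
      then show ?thesis by (simp add: grid_def field_simps del: of_nat_Suc)
    qed
    have upper: "grid n s \<le> s + inverse (real (Suc n))" for n
    proof -
      have "of_int \<lfloor>s * real (Suc n)\<rfloor> + 1 \<le> s * real (Suc n) + 1" by linarith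
      then show ?thesis by (simp add: grid_def field_simps del: of_nat_Suc)
    qed
    have upper_lim: "(\<lambda>n. s + inverse (real (Suc n))) \<longlonglongrightarrow> s"
      using tendsto_add[OF tendsto_const LIMSEQ_inverse_real_of_nat, of s] by simp
    show "(\<lambda>n. grid n s) \<longlonglongrightarrow> s"
      by (rule tendsto_sandwich[OF _ _ tendsto_const upper_lim])
         (use lower upper in \<open>simp_all add: less_imp_le\<close>)
    show "eventually (\<lambda>n. grid n s \<in> {s<..} - {s}) sequentially"
    proof (intro always_eventually allI)
      show "grid n s \<in> {s<..} - {s}" for n using lower[of n] by simp
    qed
  qed
  have "(\<lambda>p. \<Xi> (clamp_time (fst p)) (snd p)) \<in> borel_measurable (borel \<Otimes>\<^sub>M M)"
  proof (rule borel_measurable_LIMSEQ_real[OF _ m])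
    fix p assume "p \<in> space (borel \<Otimes>\<^sub>M M :: (real \<times> 'a) measure)"
    then have "snd p \<in> space M" by (auto simp: space_pair_measure)
    from filterlim_compose[OF Xi_right_continuous[OF this] grid[of "fst p"]]
    show "(\<lambda>n. \<Xi> (clamp_time (grid n (fst p))) (snd p)) \<longlonglongrightarrow> \<Xi> (clamp_time (fst p)) (snd p)" .
  qed
  then show ?thesis by (simp add: case_prod_beta)
qed

end

section \<open>Following the signal\<close>

locale tracking_problem = target_martingale M F T \<Xi>T \<Xi>
  for M :: "'a measure" and F :: "real \<Rightarrow> 'a measure" and T :: real
    and \<Xi>T :: "'a \<Rightarrow> real" and \<Xi> :: "real \<Rightarrow> 'a \<Rightarrow> real" +
  fixes \<xi> :: "real \<Rightarrow> 'a \<Rightarrow> real" and x a :: real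
  assumes xi_prog: "progressive F T \<xi>"
    and xi_L2: "mean_sq_energy M T \<xi> < \<infinity>"
    and a_pos: "0 < a" and a_le: "2 * a \<le> T"
begin

definition signal :: "real \<Rightarrow> 'a \<Rightarrow> real" where "signal t = \<xi> (clamp_time t)"
definition target :: "real \<Rightarrow> 'a \<Rightarrow> real" where "target t = \<Xi> (clamp_time t)"
definition follower :: "real \<Rightarrow> 'a \<Rightarrow> real" where
  "follower t \<omega> = tracking a x (\<lambda>s. signal s \<omega>) (clamp_time t)"

lemma signal_eq: "t \<in> {0..T} \<Longrightarrow> signal t = \<xi> t"
  and target_eq: "t \<in> {0..T} \<Longrightarrow> target t = \<Xi> t"
  by (simp_all add: signal_def target_def clamp_time_id)

lemma signal_measurable [measurable (raw)]:
  assumes "f \<in> borel_measurable N" "g \<in> measurable N M"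
  shows "(\<lambda>p. signal (f p) (g p)) \<in> borel_measurable N"
  using measurable_compose[OF measurable_Pair[OF assms] progressive_jointly_measurable[OF xi_prog]]
  by (simp add: signal_def)

lemma target_measurable [measurable (raw)]:
  assumes "f \<in> borel_measurable N" "g \<in> measurable N M"
  shows "(\<lambda>p. target (f p) (g p)) \<in> borel_measurable N"
  using measurable_compose[OF measurable_Pair[OF assms] Xi_jointly_measurable]
  by (simp add: target_def)

text \<open>For times s \<le> t the smoothing integral uses \<xi> only up to s, so \<xi> may be
  replaced by its truncation at t, which is jointly measurable for \<open>F t\<close>. Measurability
  of a parameter integral then gives the claim.\<close>

lemma progressive_follower: "progressive F T follower"
  unfolding progressive_def
proof
  fix t assume t: "t \<in> {0..T}"
  let ?N = "restrict_space borel {0..t} \<Otimes>\<^sub>M F t"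
  have [measurable]: "fst \<in> measurable ?N borel"
    by (rule measurable_compose[OF measurable_fst, of "\<lambda>s. s", simplified]) (auto intro: measurable_restrict_space1)
  have "(\<lambda>q. (snd q, snd (fst q))) \<in> measurable (?N \<Otimes>\<^sub>M lborel) (borel \<Otimes>\<^sub>M F t)"
    by measurable
  from measurable_compose[OF this progressive_stopped_measurable[OF xi_prog t]]
  have [measurable]: "(\<lambda>q. \<xi> (max 0 (min (snd q) t)) (snd (fst q))) \<in> borel_measurable (?N \<Otimes>\<^sub>M lborel)"
    by simp
  have "(\<lambda>p. exp (- fst p / a) * x + (\<integral>r. (if 0 \<le> r \<and> r \<le> fst p then 1 else 0) *
      (exp (- (fst p - r) / a) / a * \<xi> (max 0 (min r t)) (snd p)) \<partial>lborel)) \<in> borel_measurable ?N"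
    by measurable
  also have "?this \<longleftrightarrow> (\<lambda>p. follower (fst p) (snd p)) \<in> borel_measurable ?N"
  proof (rule measurable_cong)
    fix p assume "p \<in> space ?N"
    then have p: "fst p \<in> {0..t}" by (auto simp: space_pair_measure space_restrict_space)
    then have c: "clamp_time (fst p) = fst p" using t by (simp add: clamp_time_id)
    have "(\<lambda>r. (if 0 \<le> r \<and> r \<le> fst p then 1 else 0) * (exp (- (fst p - r) / a) / a * \<xi> (max 0 (min r t)) (snd p)))
       = (\<lambda>r. indicator {0..fst p} r *\<^sub>R (exp (- (fst p - r) / a) / a * signal r (snd p)))"
      using p t by (auto simp: fun_eq_iff indicator_def signal_def clamp_time_def)
    then show "exp (- fst p / a) * x + (\<integral>r. (if 0 \<le> r \<and> r \<le> fst p then 1 else 0) *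
        (exp (- (fst p - r) / a) / a * \<xi> (max 0 (min r t)) (snd p)) \<partial>lborel) = follower (fst p) (snd p)"
      unfolding follower_def tracking_def c set_lebesgue_integral_def by (simp only:)
  qed
  finally show "(\<lambda>(s, \<omega>). follower s \<omega>) \<in> borel_measurable ?N"
    by (simp add: case_prod_beta)
qed

lemma follower_measurable [measurable (raw)]:
  assumes "f \<in> borel_measurable N" "g \<in> measurable N M"
  shows "(\<lambda>p. follower (f p) (g p)) \<in> borel_measurable N"
proof -
  have "follower (clamp_time s) = follower s" for s
    by (simp add: follower_def clamp_time_id fun_eq_iff)
  then show ?thesis
    using measurable_compose[OF measurable_Pair[OF assms] progressive_jointly_measurable[OF progressive_follower]]
    by simp
qed

lemma signal_path_measurable: "\<omega> \<in> space M \<Longrightarrow> (\<lambda>t. signal t \<omega>) \<in> borel_measurable borel"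
  by measurable

lemma signal_path_integrable: "AE \<omega> in M. set_integrable lborel {0..T} (\<lambda>t. signal t \<omega>)"
proof -
  have "(\<integral>\<^sup>+t\<in>{0..T}. ennreal ((signal t \<omega>)\<^sup>2) \<partial>lborel) = (\<integral>\<^sup>+t\<in>{0..T}. ennreal ((\<xi> t \<omega>)\<^sup>2) \<partial>lborel)" for \<omega>
    by (intro nn_integral_cong) (auto simp: indicator_def signal_eq)
  with xi_L2 have "(\<integral>\<^sup>+\<omega>. (\<integral>\<^sup>+t\<in>{0..T}. ennreal ((signal t \<omega>)\<^sup>2) \<partial>lborel) \<partial>M) < \<infinity>"
    by (simp add: mean_sq_energy_def)
  then have "AE \<omega> in M. (\<integral>\<^sup>+t\<in>{0..T}. ennreal ((signal t \<omega>)\<^sup>2) \<partial>lborel) \<noteq> \<infinity>"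
    by (intro nn_integral_PInf_AE) (auto simp: less_top[symmetric])
  then show ?thesis
    using AE_space
    by eventually_elim (auto intro!: set_integrable_of_square signal_path_measurable simp: less_top)
qed

text \<open>The pathwise estimate applies where the path of \<open>signal\<close> is integrable,
  that is almost surely. Tonelli exchanges \<omega> and the lag h, after which the inner expectation
  is \<open>sq_modulus\<close>.\<close>

lemma follower_error_le:
  "(\<integral>\<^sup>+\<omega>. (\<integral>\<^sup>+t\<in>{0..T}. ennreal ((follower t \<omega> - signal t \<omega>)\<^sup>2) \<partial>lborel) \<partial>M) \<le> Omega_term M T x \<xi> a"
proof -
  define S where "S = (\<lambda>h \<omega>. \<integral>\<^sup>+t\<in>{0..T}. ennreal (\<bar>signal t \<omega> - signal (max (t - h) 0) \<omega>\<bar>\<^sup>2) \<partial>lborel)"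
  have "(\<lambda>p. S (fst p) (snd p)) \<in> borel_measurable (borel \<Otimes>\<^sub>M M)"
    unfolding S_def by (rule lborel.borel_measurable_nn_integral) measurable
  note [measurable (raw)] = jointly_measurable_compose[of S, OF this]
  interpret LM: pair_sigma_finite lborel M ..
  have "(\<integral>\<^sup>+\<omega>. (\<integral>\<^sup>+t\<in>{0..T}. ennreal ((follower t \<omega> - signal t \<omega>)\<^sup>2) \<partial>lborel) \<partial>M)
    \<le> (\<integral>\<^sup>+\<omega>. ennreal a * ennreal ((x - signal 0 \<omega>)\<^sup>2)
      + ennreal (2 / a) * (\<integral>\<^sup>+h\<in>{0<..}. (ennreal (exp (- h / a)) * S h \<omega>) \<partial>lborel) \<partial>M)"
  proof (rule nn_integral_mono_AE)
    show "AE \<omega> in M. (\<integral>\<^sup>+t\<in>{0..T}. ennreal ((follower t \<omega> - signal t \<omega>)\<^sup>2) \<partial>lborel)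
      \<le> ennreal a * ennreal ((x - signal 0 \<omega>)\<^sup>2)
      + ennreal (2 / a) * (\<integral>\<^sup>+h\<in>{0<..}. (ennreal (exp (- h / a)) * S h \<omega>) \<partial>lborel)"
      using signal_path_integrable AE_space
    proof eventually_elim
      fix \<omega> assume i: "set_integrable lborel {0..T} (\<lambda>t. signal t \<omega>)" and \<omega>: "\<omega> \<in> space M"
      have "(\<integral>\<^sup>+t\<in>{0..T}. ennreal ((follower t \<omega> - signal t \<omega>)\<^sup>2) \<partial>lborel)
        = (\<integral>\<^sup>+t\<in>{0..T}. ennreal ((tracking a x (\<lambda>s. signal s \<omega>) t - signal t \<omega>)\<^sup>2) \<partial>lborel)"
        by (intro nn_integral_cong) (auto simp: indicator_def follower_def clamp_time_id)
      also have "\<dots> \<le> ennreal a * ennreal ((x - signal 0 \<omega>)\<^sup>2)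
        + ennreal (2 / a) * (\<integral>\<^sup>+h\<in>{0<..}. (ennreal (exp (- h / a)) * S h \<omega>) \<partial>lborel)"
        unfolding S_def
        by (rule tracking_error_energy_le[OF a_pos _ signal_path_measurable[OF \<omega>] i]) (use T_pos in simp)
      finally show "(\<integral>\<^sup>+t\<in>{0..T}. ennreal ((follower t \<omega> - signal t \<omega>)\<^sup>2) \<partial>lborel) \<le> \<dots>" .
    qed
  qed
  also have "\<dots> = ennreal a * (\<integral>\<^sup>+\<omega>. ennreal ((x - signal 0 \<omega>)\<^sup>2) \<partial>M)
      + ennreal (2 / a) * (\<integral>\<^sup>+\<omega>. (\<integral>\<^sup>+h\<in>{0<..}. (ennreal (exp (- h / a)) * S h \<omega>) \<partial>lborel) \<partial>M)"
    by (subst nn_integral_add) (auto simp: nn_integral_cmult)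
  also have "(\<integral>\<^sup>+\<omega>. (\<integral>\<^sup>+h\<in>{0<..}. (ennreal (exp (- h / a)) * S h \<omega>) \<partial>lborel) \<partial>M)
      = (\<integral>\<^sup>+h. (\<integral>\<^sup>+\<omega>. (ennreal (exp (- h / a)) * S h \<omega>) * indicator {0<..} h \<partial>M) \<partial>lborel)"
    by (rule LM.Fubini') measurable
  also have "\<dots> = (\<integral>\<^sup>+h\<in>{0<..}. (ennreal (exp (- h / a)) * sq_modulus M T \<xi> h) \<partial>lborel)"
  proof (rule nn_integral_cong)
    fix h :: real
    have "sq_modulus M T \<xi> h = (\<integral>\<^sup>+\<omega>. S h \<omega> \<partial>M)" if "h > 0"
      unfolding sq_modulus_def S_def
      by (intro nn_integral_cong) (use that in \<open>auto simp: indicator_def signal_eq\<close>)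
    then show "(\<integral>\<^sup>+\<omega>. (ennreal (exp (- h / a)) * S h \<omega>) * indicator {0<..} h \<partial>M)
      = (ennreal (exp (- h / a)) * sq_modulus M T \<xi> h) * indicator {0<..} h"
      by (cases "h > 0") (auto simp: nn_integral_cmult)
  qed
  also have "(\<integral>\<^sup>+\<omega>. ennreal ((x - signal 0 \<omega>)\<^sup>2) \<partial>M) = (\<integral>\<^sup>+\<omega>. ennreal ((x - \<xi> 0 \<omega>)\<^sup>2) \<partial>M)"
    using T_pos by (simp add: signal_eq)
  finally show ?thesis by (simp add: Omega_term_def)
qed

lemma Theta_term_eq:
  "Theta_term M T \<xi> \<Xi> a = (\<integral>\<^sup>+\<omega>. (\<integral>\<^sup>+t\<in>{T - 2 * a..T}. ennreal ((signal t \<omega> - target t \<omega>)\<^sup>2) \<partial>lborel) \<partial>M)"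
  unfolding Theta_term_def
  by (intro nn_integral_cong) (use a_le in \<open>auto simp: indicator_def signal_eq target_eq\<close>)

text \<open>Split at \<xi>, the squared distance integrates over the window to at most 2 \<Omega> +
  2 \<Theta>. The window has length a, so the distance cannot exceed the average bound c
  throughout.\<close>

lemma exists_switching_time:
  obtains \<tau> where "\<tau> \<in> {T - 2 * a..T - a}"
    "(\<integral>\<^sup>+\<omega>. ennreal ((target \<tau> \<omega> - follower \<tau> \<omega>)\<^sup>2) \<partial>M) \<le> ennreal (2 / a) * (Omega_term M T x \<xi> a + Theta_term M T \<xi> \<Xi> a)"
proof -
  let ?I = "{T - 2 * a..T - a}"
  interpret LM: pair_sigma_finite lborel M ..
  define g where "g = (\<lambda>t. \<integral>\<^sup>+\<omega>. ennreal ((target t \<omega> - follower t \<omega>)\<^sup>2) \<partial>M)"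
  define c where "c = ennreal (2 / a) * (Omega_term M T x \<xi> a + Theta_term M T \<xi> \<Xi> a)"
  have [measurable]: "g \<in> borel_measurable borel"
    unfolding g_def by (rule borel_measurable_nn_integral) measurable
  have c: "c * ennreal a = 2 * Omega_term M T x \<xi> a + 2 * Theta_term M T \<xi> \<Xi> a"
  proof -
    have "ennreal (2 / a) * ennreal a = 2"
      using a_pos by (simp add: ennreal_mult[symmetric] flip: ennreal_numeral)
    then show ?thesis unfolding c_def by (metis mult.commute mult.left_commute distrib_left)
  qed
  have "(\<integral>\<^sup>+t. g t * indicator ?I t \<partial>lborel) = (\<integral>\<^sup>+t. (\<integral>\<^sup>+\<omega>. ennreal ((target t \<omega> - follower t \<omega>)\<^sup>2) * indicator ?I t \<partial>M) \<partial>lborel)"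
    unfolding g_def by (intro nn_integral_cong nn_integral_multc[symmetric]) measurable
  also have "\<dots> = (\<integral>\<^sup>+\<omega>. (\<integral>\<^sup>+t. ennreal ((target t \<omega> - follower t \<omega>)\<^sup>2) * indicator ?I t \<partial>lborel) \<partial>M)"
    by (rule LM.Fubini'[symmetric]) measurable
  also have "\<dots> \<le> (\<integral>\<^sup>+\<omega>. (\<integral>\<^sup>+t. 2 * (ennreal ((follower t \<omega> - signal t \<omega>)\<^sup>2) * indicator {0..T} t)
      + 2 * (ennreal ((signal t \<omega> - target t \<omega>)\<^sup>2) * indicator {T - 2 * a..T} t) \<partial>lborel) \<partial>M)"
  proof (intro nn_integral_mono)
    fix \<omega> t
    have "ennreal ((target t \<omega> - follower t \<omega>)\<^sup>2) \<le> ennreal (2 * (follower t \<omega> - signal t \<omega>)\<^sup>2 + 2 * (signal t \<omega> - target t \<omega>)\<^sup>2)"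
      using square_add_le[of "follower t \<omega> - signal t \<omega>" "signal t \<omega> - target t \<omega>"]
      by (intro ennreal_leI) (simp add: power2_commute)
    then show "ennreal ((target t \<omega> - follower t \<omega>)\<^sup>2) * indicator ?I t
      \<le> 2 * (ennreal ((follower t \<omega> - signal t \<omega>)\<^sup>2) * indicator {0..T} t)
      + 2 * (ennreal ((signal t \<omega> - target t \<omega>)\<^sup>2) * indicator {T - 2 * a..T} t)"
      using a_pos a_le by (auto simp: indicator_def ennreal_mult')
  qed
  also have "\<dots> = 2 * (\<integral>\<^sup>+\<omega>. (\<integral>\<^sup>+t\<in>{0..T}. ennreal ((follower t \<omega> - signal t \<omega>)\<^sup>2) \<partial>lborel) \<partial>M) + 2 * Theta_term M T \<xi> \<Xi> a"
    unfolding Theta_term_eq by (simp add: nn_integral_add nn_integral_cmult cong: nn_integral_cong_simp)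
  also have "\<dots> \<le> c * ennreal a"
    unfolding c by (intro add_right_mono mult_left_mono follower_error_le) simp
  finally have g_le: "(\<integral>\<^sup>+t. g t * indicator ?I t \<partial>lborel) \<le> c * ennreal a" .
  have "\<exists>\<tau>\<in>?I. g \<tau> \<le> c"
  proof (rule ccontr)
    assume "\<not> (\<exists>\<tau>\<in>?I. g \<tau> \<le> c)"
    then have gt: "c < g t" if "t \<in> ?I" for t using that by (auto simp: not_le)
    \<comment> \<open>The strict comparison of integrals requires the smaller one to be
      finite.\<close>
    have "c \<noteq> \<infinity>" using gt[of "T - a"] a_pos by auto
    have ci: "(\<integral>\<^sup>+t. c * indicator ?I t \<partial>lborel) = c * ennreal a"
      using a_pos by (simp add: nn_integral_cmult)
    have "(\<integral>\<^sup>+t. c * indicator ?I t \<partial>lborel) < (\<integral>\<^sup>+t. g t * indicator ?I t \<partial>lborel)"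
    proof (rule nn_integral_less)
      show "(\<integral>\<^sup>+t. c * indicator ?I t \<partial>lborel) \<noteq> \<infinity>"
        unfolding ci using \<open>c \<noteq> \<infinity>\<close> by (simp add: ennreal_mult_eq_top_iff)
      show "AE t in lborel. c * indicator ?I t \<le> g t * indicator ?I t"
        using gt by (intro AE_I2) (auto simp: indicator_def less_imp_le)
      show "\<not> (AE t in lborel. g t * indicator ?I t \<le> c * indicator ?I t)"
      proof
        assume "AE t in lborel. g t * indicator ?I t \<le> c * indicator ?I t"
        then have "AE t in lborel. t \<notin> ?I"
          by eventually_elim (use gt in \<open>fastforce simp: indicator_def\<close>)
        then have "emeasure lborel ?I = 0"
          by (subst AE_iff_measurable[symmetric, where P="\<lambda>t. t \<notin> ?I"]) auto
        with a_pos show False by simp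
      qed
    qed measurable
    with g_le ci show False by simp
  qed
  then show thesis using that unfolding g_def c_def by blast
qed

end

section \<open>The dyadic bridge\<close>

lemma suminf_indicator_disjoint:
  fixes c :: "nat \<Rightarrow> real"
  assumes "disjoint_family A" "t \<in> A k"
  shows "(\<Sum>j. indicator (A j) t * c j) = c k"
proof -
  have "(\<lambda>j. indicator (A j) t * c j) = (\<lambda>j. if j = k then c j else 0)"
    using assms by (auto simp: fun_eq_iff indicator_def disjoint_family_on_def)
  then show ?thesis using sums_single[of k c] by (simp add: sums_iff)
qed

locale dyadic_bridge = tracking_problem M F T \<Xi>T \<Xi> \<xi> x a
  for M :: "'a measure" and F :: "real \<Rightarrow> 'a measure" and T :: real
    and \<Xi>T :: "'a \<Rightarrow> real" and \<Xi> \<xi> :: "real \<Rightarrow> 'a \<Rightarrow> real" and x a :: real +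
  fixes \<tau> :: real
  assumes tau: "\<tau> \<in> {T - 2 * a..T - a}"
    and tau_L2: "square_integrable M (\<lambda>\<omega>. target \<tau> \<omega> - follower \<tau> \<omega>)"
begin

definition node :: "nat \<Rightarrow> real" where "node k = T - (T - \<tau>) / 2 ^ k"
definition gap :: "nat \<Rightarrow> real" where "gap k = (T - \<tau>) / 2 ^ Suc k"
definition cell :: "nat \<Rightarrow> real set" where "cell k = {node k..<node (Suc k)}"

text \<open>The intended state at \<open>node k\<close>. The index lags by one so that the endpoint
  \<open>anchor (Suc k)\<close> of a cell is already known at its left end \<open>node k\<close>;
  the follower occurs only in the first step.\<close>

fun anchor :: "nat \<Rightarrow> 'a \<Rightarrow> real" where
  "anchor 0 = follower \<tau>"
| "anchor (Suc k) = target (node k)"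

definition step_energy :: "nat \<Rightarrow> real" where
  "step_energy k = (\<integral>\<omega>. (anchor (Suc k) \<omega> - anchor k \<omega>)\<^sup>2 \<partial>M)"

definition segment :: "nat \<Rightarrow> real \<Rightarrow> 'a \<Rightarrow> real" where
  "segment k t \<omega> = anchor k \<omega> + (t - node k) / gap k * (anchor (Suc k) \<omega> - anchor k \<omega>)"

text \<open>Writing the slopes as a countable sum with indicators, of which at most one is nonzero,
  makes progressive measurability accessible. The time T belongs to no cell, so the control vanishes
  there.\<close>

definition bridge_control :: "real \<Rightarrow> 'a \<Rightarrow> real" where
  "bridge_control t \<omega> = (if t < \<tau> then (\<xi> t \<omega> - follower t \<omega>) / a
     else (\<Sum>k. indicator (cell k) t * ((anchor (Suc k) \<omega> - anchor k \<omega>) / gap k)))"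

lemma tau_bounds: "0 \<le> \<tau>" "\<tau> < T" "\<tau> \<le> T" "a \<le> T - \<tau>" "T - \<tau> \<le> 2 * a"
  using tau a_pos a_le by auto

lemma gap_pos: "0 < gap k" using tau_bounds by (simp add: gap_def)
lemma node_0: "node 0 = \<tau>" by (simp add: node_def)
lemma node_Suc: "node (Suc k) = node k + gap k" by (simp add: node_def gap_def field_simps)
lemma remaining_eq: "T - node k = 2 * gap k" by (simp add: node_def gap_def field_simps)
lemma gap_Suc: "gap (Suc k) = gap k / 2" by (simp add: gap_def)
lemma gap_0: "gap 0 = (T - \<tau>) / 2" by (simp add: gap_def)

lemma gap_le: "gap k \<le> a"
proof (induction k)
  case (Suc k)
  then show ?case using gap_pos[of k] by (simp add: gap_Suc)
qed (use tau_bounds in \<open>simp add: gap_0\<close>)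

lemma node_less: "node k < T" using remaining_eq[of k] gap_pos[of k] by simp
lemma node_incseq: "incseq node" using gap_pos by (auto intro!: incseq_SucI simp: node_Suc less_imp_le)
lemma node_ge: "\<tau> \<le> node k" using incseqD[OF node_incseq, of 0 k] by (simp add: node_0)
lemma node_mem: "node k \<in> {0..T}" "0 \<le> node k" "node k \<le> T"
  using node_ge[of k] node_less[of k] tau_bounds by auto

lemma node_tendsto: "node \<longlonglongrightarrow> T"
proof -
  have "(\<lambda>k. T - (T - \<tau>) * (1 / 2) ^ k) \<longlonglongrightarrow> T - (T - \<tau>) * 0"
    by (intro tendsto_intros LIMSEQ_realpow_zero) auto
  then show ?thesis by (simp add: node_def[abs_def] power_divide)
qed

lemma cell_disjoint: "disjoint_family cell"
  unfolding disjoint_family_on_def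
proof (intro ballI impI)
  fix i j :: nat assume "i \<noteq> j"
  then have "Suc i \<le> j \<or> Suc j \<le> i" by linarith
  then have "node (Suc i) \<le> node j \<or> node (Suc j) \<le> node i" using incseqD[OF node_incseq] by metis
  then show "cell i \<inter> cell j = {}" by (auto simp: cell_def)
qed

lemma cell_exists:
  assumes "\<tau> \<le> t" "t < T"
  obtains k where "t \<in> cell k"
proof -
  have "eventually (\<lambda>n. t < node n) sequentially"
    by (rule order_tendstoD(1)[OF node_tendsto assms(2)])
  then have ex: "\<exists>n. t < node n" by (auto simp: eventually_sequentially)
  define n where "n = (LEAST n. t < node n)"
  have n: "t < node n" unfolding n_def using ex by (rule LeastI_ex)
  then have "n \<noteq> 0" using assms(1) node_0 by (cases n) auto
  then obtain k where k: "n = Suc k" by (cases n) auto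
  have "\<not> t < node k" using not_less_Least[of k "\<lambda>n. t < node n"] k unfolding n_def by simp
  with n k that[of k] show thesis by (auto simp: cell_def)
qed

lemma cell_bounds: "t \<in> cell k \<Longrightarrow> \<tau> \<le> t \<and> t < T \<and> t \<in> {0..T}"
  using node_ge[of k] node_less[of "Suc k"] tau_bounds by (auto simp: cell_def)

lemma sets_cell [measurable]: "cell k \<in> sets borel"
  by (simp add: cell_def)

lemma emeasure_cell: "emeasure lborel (cell k) = ennreal (gap k)"
  using gap_pos[of k] by (simp add: cell_def node_Suc)

lemma bridge_control_cell:
  "t \<in> cell k \<Longrightarrow> bridge_control t \<omega> = (anchor (Suc k) \<omega> - anchor k \<omega>) / gap k"
proof -
  assume t: "t \<in> cell k"
  then have "\<not> t < \<tau>" using cell_bounds by fastforce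
  then show ?thesis
    by (simp only: bridge_control_def if_False suminf_indicator_disjoint[OF cell_disjoint t])
qed

lemma anchor_adapted: "anchor k \<in> borel_measurable (F (node k))"
proof (cases k)
  case 0
  then show ?thesis using progressive_section[OF progressive_follower, of \<tau>] tau_bounds by (simp add: node_0)
next
  case (Suc j)
  have "target (node j) \<in> borel_measurable (F (node j))"
    using Xi_measurable[OF node_mem(1)] by (simp add: target_eq node_mem)
  then show ?thesis
    using filtration_measurable_mono[of "node j" "node k"] incseqD[OF node_incseq, of j k] Suc
    by (auto simp: node_mem)
qed

lemma anchor_Suc_adapted: "anchor (Suc k) \<in> borel_measurable (F (node k))"
  using Xi_measurable[OF node_mem(1)] by (simp add: target_eq node_mem)

lemma target_square_integrable: "square_integrable M (target t)"
  unfolding target_def by (rule Xi_square_integrable) simp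

lemma anchor_square_integrable: "square_integrable M (anchor k)"
proof (cases k)
  case 0
  have "square_integrable M (\<lambda>\<omega>. target \<tau> \<omega> - (target \<tau> \<omega> - follower \<tau> \<omega>))"
    by (intro square_integrable_diff target_square_integrable tau_L2)
  then show ?thesis using 0 by simp
qed (simp add: target_square_integrable)

lemma anchor_measurable [measurable]: "anchor k \<in> borel_measurable M"
  using anchor_square_integrable by (simp add: square_integrable_def)

lemma step_energy_nonneg: "0 \<le> step_energy k"
  by (simp add: step_energy_def)

lemma step_energy_nn_integral:
  "(\<integral>\<^sup>+\<omega>. ennreal ((anchor (Suc k) \<omega> - anchor k \<omega>)\<^sup>2) \<partial>M) = ennreal (step_energy k)"
  unfolding step_energy_def
  by (intro square_integrable_nn_integral square_integrable_diff anchor_square_integrable)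

lemma step_energy_Suc: "step_energy (Suc k) = second_moment (node (Suc k)) - second_moment (node k)"
  using Xi_increment[of "node k" "node (Suc k)"] incseqD[OF node_incseq, of k "Suc k"]
  by (simp add: step_energy_def target_eq node_mem)

lemma step_energy_Suc_le:
  "ennreal (step_energy (Suc k)) \<le> ennreal (2 * gap k) * reach_increment (node k) (node (Suc k))"
  using second_moment_increment_le[of "node k" "node (Suc k)"] incseqD[OF node_incseq, of k "Suc k"]
  by (simp add: step_energy_Suc remaining_eq node_mem)

text \<open>The segment is known at \<open>node k\<close>, so Pythagoras splits its error into the
  information revealed since \<open>node k\<close>, at most the next step energy, and the distance
  still to be covered, a fraction 1 - \<theta> of the current step.\<close>

lemma segment_error_le:
  assumes t: "t \<in> cell k"
  shows "(\<integral>\<^sup>+\<omega>. ennreal ((segment k t \<omega> - target t \<omega>)\<^sup>2) \<partial>M) \<le> ennreal (step_energy k + step_energy (Suc k))"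
proof -
  have t': "node k \<le> t" "t \<le> node (Suc k)" "t \<le> T" "0 \<le> t"
    using t cell_bounds[OF t] by (auto simp: cell_def)
  define \<theta> where "\<theta> = (t - node k) / gap k"
  have \<theta>: "0 \<le> \<theta>" "\<theta> \<le> 1"
    using t' gap_pos[of k] by (auto simp: \<theta>_def node_Suc field_simps)
  have seg: "segment k t = (\<lambda>\<omega>. anchor k \<omega> + \<theta> * (anchor (Suc k) \<omega> - anchor k \<omega>))"
    by (simp add: segment_def[abs_def] \<theta>_def)
  have Z: "segment k t \<in> borel_measurable (F (node k))"
    unfolding seg using anchor_adapted[of k] anchor_Suc_adapted[of k] by measurable
  have Z2: "square_integrable M (segment k t)"
    unfolding seg by (intro square_integrable_add square_integrable_cmult square_integrable_diff anchor_square_integrable)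
  have "(\<integral>\<omega>. (target t \<omega> - segment k t \<omega>)\<^sup>2 \<partial>M)
      = (\<integral>\<omega>. (\<Xi> t \<omega> - \<Xi> (node k) \<omega>)\<^sup>2 \<partial>M) + (\<integral>\<omega>. (\<Xi> (node k) \<omega> - segment k t \<omega>)\<^sup>2 \<partial>M)"
    using Xi_pythagoras[OF node_mem(2) t'(1) t'(3) Z Z2] t' by (simp add: target_eq)
  also have "(\<integral>\<omega>. (\<Xi> t \<omega> - \<Xi> (node k) \<omega>)\<^sup>2 \<partial>M) \<le> step_energy (Suc k)"
    using Xi_increment[OF node_mem(2) t'(1) t'(3)] second_moment_mono[OF t'(2)] by (simp add: step_energy_Suc)
  also have "(\<integral>\<omega>. (\<Xi> (node k) \<omega> - segment k t \<omega>)\<^sup>2 \<partial>M) = (1 - \<theta>)\<^sup>2 * step_energy k"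
  proof -
    have "\<Xi> (node k) \<omega> - segment k t \<omega> = (1 - \<theta>) * (anchor (Suc k) \<omega> - anchor k \<omega>)" for \<omega>
      by (simp add: seg target_eq node_mem algebra_simps)
    then show ?thesis by (simp add: power_mult_distrib step_energy_def)
  qed
  also have "\<dots> \<le> step_energy k"
    using \<theta> by (intro mult_left_le_one_le step_energy_nonneg) (auto simp: power_le_one)
  finally have "(\<integral>\<omega>. (target t \<omega> - segment k t \<omega>)\<^sup>2 \<partial>M) \<le> step_energy k + step_energy (Suc k)"
    by simp
  moreover have "(\<integral>\<^sup>+\<omega>. ennreal ((segment k t \<omega> - target t \<omega>)\<^sup>2) \<partial>M) = ennreal (\<integral>\<omega>. (target t \<omega> - segment k t \<omega>)\<^sup>2 \<partial>M)"
    using square_integrable_nn_integral[OF square_integrable_diff[OF target_square_integrable Z2]]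
    by (simp add: power2_commute)
  ultimately show ?thesis by (simp add: ennreal_leI)
qed

text \<open>Each summand is measurable separately: a cell starting by time t has anchors known at
  time t, and the indicator of a later cell vanishes on [0, t].\<close>

lemma progressive_bridge_control: "progressive F T bridge_control"
  unfolding progressive_def
proof
  fix t assume t: "t \<in> {0..T}"
  let ?N = "restrict_space borel {0..t} \<Otimes>\<^sub>M F t"
  have [measurable]: "fst \<in> measurable ?N borel"
    by (rule measurable_compose[OF measurable_fst, of "\<lambda>s. s", simplified]) (auto intro: measurable_restrict_space1)
  have [measurable]: "(\<lambda>p. \<xi> (fst p) (snd p)) \<in> borel_measurable ?N" "(\<lambda>p. follower (fst p) (snd p)) \<in> borel_measurable ?N"
    using xi_prog progressive_follower t unfolding progressive_def case_prod_beta by blast+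
  have [measurable]: "(\<lambda>p. indicator (cell k) (fst p) * ((anchor (Suc k) (snd p) - anchor k (snd p)) / gap k)) \<in> borel_measurable ?N" for k
  proof (cases "node k \<le> t")
    case True
    have [measurable]: "anchor k \<in> borel_measurable (F t)" "anchor (Suc k) \<in> borel_measurable (F t)"
      using filtration_measurable_mono[OF node_mem(2) True _ anchor_adapted]
        filtration_measurable_mono[OF node_mem(2) True _ anchor_Suc_adapted] t by auto
    show ?thesis by measurable
  next
    case False
    have "(\<lambda>p. indicator (cell k) (fst p) * ((anchor (Suc k) (snd p) - anchor k (snd p)) / gap k)) \<in> borel_measurable ?N
      \<longleftrightarrow> (\<lambda>p. 0 :: real) \<in> borel_measurable ?N"
      by (rule measurable_cong)
         (use False in \<open>auto simp: space_pair_measure space_restrict_space cell_def indicator_def\<close>)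
    then show ?thesis by simp
  qed
  show "(\<lambda>(s, \<omega>). bridge_control s \<omega>) \<in> borel_measurable ?N"
    unfolding bridge_control_def case_prod_beta by measurable
qed

text \<open>The step energies \<open>k \<ge> 1\<close> are increments of the second moment over cells at distance comparable
  to their length from \<open>T\<close>, hence controlled by the reachability integral; only \<open>step_energy 0\<close>,
  the squared distance at the switching time, remains.\<close>

lemma bridge_energy_le:
  "(\<Sum>k. ennreal (gap k * (step_energy k + step_energy (Suc k)))) + (\<Sum>k. ennreal (a\<^sup>2 / 2 * (step_energy k / gap k)))
    \<le> ennreal (3 / 2 * a * step_energy 0) + ennreal (5 * a\<^sup>2) * Lambda_term M T \<Xi> a"
proof -
  \<comment> \<open>Per cell, \<alpha> collects what the current step costs, in deviation and
    effort, and \<beta> the deviation caused by information arriving during the cell.\<close>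
  define \<alpha> where "\<alpha> = (\<lambda>k. ennreal ((gap k + a\<^sup>2 / (2 * gap k)) * step_energy k))"
  define \<beta> where "\<beta> = (\<lambda>k. ennreal (gap k * step_energy (Suc k)))"
  define \<nu> where "\<nu> = (\<lambda>k. reach_increment (node k) (node (Suc k)))"
  note nn = step_energy_nonneg less_imp_le[OF gap_pos]
  have "(\<Sum>k. ennreal (gap k * (step_energy k + step_energy (Suc k)))) + (\<Sum>k. ennreal (a\<^sup>2 / 2 * (step_energy k / gap k)))
    = (\<Sum>k. ennreal (gap k * (step_energy k + step_energy (Suc k))) + ennreal (a\<^sup>2 / 2 * (step_energy k / gap k)))"
    by (rule suminf_add) auto
  also have "\<dots> = (\<Sum>k. \<alpha> k + \<beta> k)"
  proof (rule suminf_cong)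
    fix k
    have "gap k * (step_energy k + step_energy (Suc k)) + a\<^sup>2 / 2 * (step_energy k / gap k)
      = (gap k + a\<^sup>2 / (2 * gap k)) * step_energy k + gap k * step_energy (Suc k)"
      by (simp add: algebra_simps)
    then show "ennreal (gap k * (step_energy k + step_energy (Suc k))) + ennreal (a\<^sup>2 / 2 * (step_energy k / gap k)) = \<alpha> k + \<beta> k"
      unfolding \<alpha>_def \<beta>_def using nn by (subst (1 2) ennreal_plus[symmetric]) auto
  qed
  also have "\<dots> = (\<Sum>k. \<alpha> k) + (\<Sum>k. \<beta> k)"
    by (rule suminf_add[symmetric]) auto
  \<comment> \<open>The shift pairs \<open>\<alpha> (Suc k)\<close> with \<open>\<beta> k\<close>:
    both are multiples of \<open>step_energy (Suc k)\<close>. Only the initial distance in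
    \<open>\<alpha> 0\<close> is left over.\<close>
  also have "(\<Sum>k. \<alpha> k) = (\<Sum>k. \<alpha> (Suc k)) + \<alpha> 0"
    using suminf_offset[of \<alpha> 1] by simp
  also have "(\<Sum>k. \<alpha> (Suc k)) + \<alpha> 0 + (\<Sum>k. \<beta> k) = \<alpha> 0 + (\<Sum>k. \<alpha> (Suc k) + \<beta> k)"
    by (subst suminf_add[symmetric]) (auto simp: ac_simps)
  also have "\<dots> \<le> ennreal (3 / 2 * a * step_energy 0) + (\<Sum>k. ennreal (5 * a\<^sup>2) * \<nu> k)"
  proof (intro add_mono suminf_le allI)
    define g where "g = gap 0"
    have g: "a / 2 \<le> g" "g \<le> a" "0 < g"
      using tau_bounds gap_pos[of 0] by (auto simp: g_def gap_0)
    \<comment> \<open>The function g + a^2/(2g) is convex and equals 3a/2 at both ends of [a/2, a];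
      the product encodes this.\<close>
    then have "0 \<le> (a - g) * (2 * g - a)" by simp
    then have "g + a\<^sup>2 / (2 * g) \<le> 3 / 2 * a"
      using g by (simp add: field_simps power2_eq_square)
    then show "\<alpha> 0 \<le> ennreal (3 / 2 * a * step_energy 0)"
      unfolding \<alpha>_def g_def using nn by (intro ennreal_leI mult_right_mono) auto
  next
    fix k
    define g where "g = gap k"
    have g: "0 < g" "g \<le> a" using gap_pos gap_le by (auto simp: g_def)
    have "\<alpha> (Suc k) + \<beta> k = ennreal ((3 / 2 * g + a\<^sup>2 / g) * step_energy (Suc k))"
    proof -
      have "(gap (Suc k) + a\<^sup>2 / (2 * gap (Suc k))) * step_energy (Suc k) + gap k * step_energy (Suc k)
        = (3 / 2 * g + a\<^sup>2 / g) * step_energy (Suc k)"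
        using g by (simp add: gap_Suc g_def field_simps)
      then show ?thesis
        unfolding \<alpha>_def \<beta>_def using nn by (subst ennreal_plus[symmetric]) auto
    qed
    also have "\<dots> = ennreal (3 / 2 * g + a\<^sup>2 / g) * ennreal (step_energy (Suc k))"
      using g by (intro ennreal_mult nn) auto
    also have "\<dots> \<le> ennreal (3 / 2 * g + a\<^sup>2 / g) * (ennreal (2 * g) * \<nu> k)"
      unfolding g_def \<nu>_def by (intro mult_left_mono step_energy_Suc_le) simp
    also have "\<dots> = ennreal ((3 / 2 * g + a\<^sup>2 / g) * (2 * g)) * \<nu> k"
      using g by (subst ennreal_mult) (auto simp: mult.assoc)
    also have "\<dots> \<le> ennreal (5 * a\<^sup>2) * \<nu> k"
    proof (intro mult_right_mono ennreal_leI)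
      \<comment> \<open>Origin of the constant 5: the factor 2g is the remaining time T -
        \<open>node k\<close>; it cancels the 1/g of the effort, and g \<le> a does the
        rest.\<close>
      have "(3 / 2 * g + a\<^sup>2 / g) * (2 * g) = 3 * g\<^sup>2 + 2 * a\<^sup>2"
        using g by (simp add: field_simps power2_eq_square)
      moreover have "g\<^sup>2 \<le> a\<^sup>2" using g by (intro power_mono) auto
      ultimately show "(3 / 2 * g + a\<^sup>2 / g) * (2 * g) \<le> 5 * a\<^sup>2" by simp
    qed simp
    finally show "\<alpha> (Suc k) + \<beta> k \<le> ennreal (5 * a\<^sup>2) * \<nu> k" .
  qed auto
  also have "(\<Sum>k. ennreal (5 * a\<^sup>2) * \<nu> k) = ennreal (5 * a\<^sup>2) * (\<Sum>k. \<nu> k)"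
    by simp
  also have "\<dots> \<le> ennreal (5 * a\<^sup>2) * Lambda_term M T \<Xi> a"
    unfolding \<nu>_def Lambda_term_def
    by (intro mult_left_mono suminf_reach_increment_le node_incseq) (use tau in \<open>auto simp: node_0 node_mem\<close>)
  finally show ?thesis by (simp add: add_left_mono)
qed

end

section \<open>Cost and terminal state of the bridge\<close>

lemma ennreal_le_suminf: "f k \<le> (\<Sum>j. f j :: ennreal)"
proof -
  have "sum f {k} \<le> suminf f" by (rule sum_le_suminf) auto
  then show ?thesis by simp
qed

context dyadic_bridge
begin

text \<open>For \<kappa> = a^2 and control (\<xi> - X)/a this is the running cost of deviation and
  equally that of effort, so it occurs in both bounds below.\<close>

definition follower_cost :: "real \<Rightarrow> 'a \<Rightarrow> ennreal" where
  "follower_cost t \<omega> = ennreal ((follower t \<omega> - signal t \<omega>)\<^sup>2 / 2) * indicator {0..T} t"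

text \<open>A majorant of half the squared deviation from \<xi>. The regimes before and after \<tau>
  are added up, each on its own time set, so that they can be integrated independently of
  \<tau>.\<close>

definition deviation_bound :: "real \<Rightarrow> 'a \<Rightarrow> ennreal" where
  "deviation_bound t \<omega> = follower_cost t \<omega>
     + ((\<Sum>k. ennreal ((segment k t \<omega> - target t \<omega>)\<^sup>2) * indicator (cell k) t)
     + ennreal ((signal t \<omega> - target t \<omega>)\<^sup>2) * indicator {T - 2 * a..T} t)"

definition effort_bound :: "real \<Rightarrow> 'a \<Rightarrow> ennreal" where
  "effort_bound t \<omega> = follower_cost t \<omega>
     + (\<Sum>k. ennreal (a\<^sup>2 / 2 * ((anchor (Suc k) \<omega> - anchor k \<omega>) / gap k)\<^sup>2) * indicator (cell k) t)"

lemma segment_measurable [measurable (raw)]: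
  assumes [measurable]: "f \<in> borel_measurable N" "g \<in> measurable N M"
  shows "(\<lambda>p. segment k (f p) (g p)) \<in> borel_measurable N"
  unfolding segment_def by measurable

lemma follower_cost_measurable [measurable (raw)]:
  assumes [measurable]: "f \<in> borel_measurable N" "g \<in> measurable N M"
  shows "(\<lambda>p. follower_cost (f p) (g p)) \<in> borel_measurable N"
  unfolding follower_cost_def by measurable

lemma deviation_bound_measurable [measurable (raw)]:
  assumes [measurable]: "f \<in> borel_measurable N" "g \<in> measurable N M"
  shows "(\<lambda>p. deviation_bound (f p) (g p)) \<in> borel_measurable N"
  unfolding deviation_bound_def by measurable

lemma effort_bound_measurable [measurable (raw)]:
  assumes [measurable]: "f \<in> borel_measurable N" "g \<in> measurable N M"
  shows "(\<lambda>p. effort_bound (f p) (g p)) \<in> borel_measurable N"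
  unfolding effort_bound_def by measurable

lemma follower_cost_le:
  "(\<integral>\<^sup>+\<omega>. (\<integral>\<^sup>+t. follower_cost t \<omega> \<partial>lborel) \<partial>M) \<le> ennreal (1 / 2) * Omega_term M T x \<xi> a"
proof -
  have "(\<integral>\<^sup>+\<omega>. (\<integral>\<^sup>+t. follower_cost t \<omega> \<partial>lborel) \<partial>M)
    = (\<integral>\<^sup>+\<omega>. (\<integral>\<^sup>+t. ennreal (1 / 2) * (ennreal ((follower t \<omega> - signal t \<omega>)\<^sup>2) * indicator {0..T} t) \<partial>lborel) \<partial>M)"
  proof (intro nn_integral_cong)
    fix \<omega> t
    show "follower_cost t \<omega> = ennreal (1 / 2) * (ennreal ((follower t \<omega> - signal t \<omega>)\<^sup>2) * indicator {0..T} t)"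
      using ennreal_mult'[of "1 / 2" "(follower t \<omega> - signal t \<omega>)\<^sup>2"]
      by (simp add: follower_cost_def mult.assoc)
  qed
  also have "\<dots> = (\<integral>\<^sup>+\<omega>. ennreal (1 / 2) * (\<integral>\<^sup>+t\<in>{0..T}. ennreal ((follower t \<omega> - signal t \<omega>)\<^sup>2) \<partial>lborel) \<partial>M)"
    by (intro nn_integral_cong nn_integral_cmult) measurable
  also have "\<dots> = ennreal (1 / 2) * (\<integral>\<^sup>+\<omega>. (\<integral>\<^sup>+t\<in>{0..T}. ennreal ((follower t \<omega> - signal t \<omega>)\<^sup>2) \<partial>lborel) \<partial>M)"
    by (intro nn_integral_cmult) measurable
  also have "\<dots> \<le> ennreal (1 / 2) * Omega_term M T x \<xi> a"
    by (intro mult_left_mono follower_error_le) simp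
  finally show ?thesis .
qed

text \<open>By Tonelli, a bound on the expectation at each fixed time of a cell suffices;
  integrating it contributes the cell length \<open>gap k\<close>.\<close>

lemma nn_integral_cells_le:
  assumes f: "\<And>k. (\<lambda>p. f k (fst p) (snd p)) \<in> borel_measurable (borel \<Otimes>\<^sub>M M)"
    and le: "\<And>k t. t \<in> cell k \<Longrightarrow> (\<integral>\<^sup>+\<omega>. f k t \<omega> \<partial>M) \<le> ennreal (c k)"
  shows "(\<integral>\<^sup>+\<omega>. (\<integral>\<^sup>+t. (\<Sum>k. f k t \<omega> * indicator (cell k) t) \<partial>lborel) \<partial>M) \<le> (\<Sum>k. ennreal (gap k * c k))"
proof -
  interpret LM: pair_sigma_finite lborel M ..
  note [measurable (raw)] = jointly_measurable_compose[OF f]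
  have "(\<integral>\<^sup>+\<omega>. (\<integral>\<^sup>+t. (\<Sum>k. f k t \<omega> * indicator (cell k) t) \<partial>lborel) \<partial>M)
    = (\<integral>\<^sup>+\<omega>. (\<Sum>k. \<integral>\<^sup>+t. f k t \<omega> * indicator (cell k) t \<partial>lborel) \<partial>M)"
    by (intro nn_integral_cong nn_integral_suminf) measurable
  also have "\<dots> = (\<Sum>k. \<integral>\<^sup>+\<omega>. (\<integral>\<^sup>+t. f k t \<omega> * indicator (cell k) t \<partial>lborel) \<partial>M)"
    by (intro nn_integral_suminf) measurable
  also have "\<dots> \<le> (\<Sum>k. ennreal (gap k * c k))"
  proof (intro suminf_le allI)
    fix k
    have "(\<integral>\<^sup>+\<omega>. (\<integral>\<^sup>+t. f k t \<omega> * indicator (cell k) t \<partial>lborel) \<partial>M)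
      = (\<integral>\<^sup>+t. (\<integral>\<^sup>+\<omega>. f k t \<omega> * indicator (cell k) t \<partial>M) \<partial>lborel)"
      by (rule LM.Fubini') measurable
    also have "\<dots> \<le> (\<integral>\<^sup>+t. ennreal (c k) * indicator (cell k) t \<partial>lborel)"
    proof (rule nn_integral_mono)
      fix t
      show "(\<integral>\<^sup>+\<omega>. f k t \<omega> * indicator (cell k) t \<partial>M) \<le> ennreal (c k) * indicator (cell k) t"
        using le[of t k] by (cases "t \<in> cell k") auto
    qed
    also have "\<dots> = ennreal (c k) * ennreal (gap k)"
      by (subst nn_integral_cmult_indicator) (auto simp: emeasure_cell)
    also have "\<dots> = ennreal (gap k * c k)"
      using gap_pos[of k] by (simp add: ennreal_mult'' mult.commute)
    finally show "(\<integral>\<^sup>+\<omega>. (\<integral>\<^sup>+t. f k t \<omega> * indicator (cell k) t \<partial>lborel) \<partial>M) \<le> ennreal (gap k * c k)" .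
  qed auto
  finally show ?thesis .
qed

lemma deviation_bound_le:
  "(\<integral>\<^sup>+\<omega>. (\<integral>\<^sup>+t. deviation_bound t \<omega> \<partial>lborel) \<partial>M) \<le> ennreal (1 / 2) * Omega_term M T x \<xi> a
     + ((\<Sum>k. ennreal (gap k * (step_energy k + step_energy (Suc k)))) + Theta_term M T \<xi> \<Xi> a)"
proof -
  have "(\<integral>\<^sup>+\<omega>. (\<integral>\<^sup>+t. deviation_bound t \<omega> \<partial>lborel) \<partial>M)
    = (\<integral>\<^sup>+\<omega>. (\<integral>\<^sup>+t. follower_cost t \<omega> \<partial>lborel) +
        ((\<integral>\<^sup>+t. (\<Sum>k. ennreal ((segment k t \<omega> - target t \<omega>)\<^sup>2) * indicator (cell k) t) \<partial>lborel)
        + (\<integral>\<^sup>+t\<in>{T - 2 * a..T}. ennreal ((signal t \<omega> - target t \<omega>)\<^sup>2) \<partial>lborel)) \<partial>M)"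
    unfolding deviation_bound_def
    by (intro nn_integral_cong) (subst nn_integral_add, measurable, subst nn_integral_add, measurable)
  also have "\<dots> = (\<integral>\<^sup>+\<omega>. (\<integral>\<^sup>+t. follower_cost t \<omega> \<partial>lborel) \<partial>M) +
        ((\<integral>\<^sup>+\<omega>. (\<integral>\<^sup>+t. (\<Sum>k. ennreal ((segment k t \<omega> - target t \<omega>)\<^sup>2) * indicator (cell k) t) \<partial>lborel) \<partial>M)
        + Theta_term M T \<xi> \<Xi> a)"
    unfolding Theta_term_eq
    by (subst nn_integral_add, measurable, subst nn_integral_add, measurable)
  also have "\<dots> \<le> ennreal (1 / 2) * Omega_term M T x \<xi> a
     + ((\<Sum>k. ennreal (gap k * (step_energy k + step_energy (Suc k)))) + Theta_term M T \<xi> \<Xi> a)"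
    by (intro add_mono follower_cost_le nn_integral_cells_le segment_error_le order_refl) measurable
  finally show ?thesis .
qed

lemma effort_bound_le:
  "(\<integral>\<^sup>+\<omega>. (\<integral>\<^sup>+t. effort_bound t \<omega> \<partial>lborel) \<partial>M) \<le> ennreal (1 / 2) * Omega_term M T x \<xi> a
     + (\<Sum>k. ennreal (a\<^sup>2 / 2 * (step_energy k / gap k)))"
proof -
  have step: "(\<integral>\<^sup>+\<omega>. ennreal (a\<^sup>2 / 2 * ((anchor (Suc k) \<omega> - anchor k \<omega>) / gap k)\<^sup>2) \<partial>M)
      \<le> ennreal (a\<^sup>2 / 2 * step_energy k / (gap k)\<^sup>2)" for k
  proof -
    have "(\<integral>\<^sup>+\<omega>. ennreal (a\<^sup>2 / 2 * ((anchor (Suc k) \<omega> - anchor k \<omega>) / gap k)\<^sup>2) \<partial>M)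
      = (\<integral>\<^sup>+\<omega>. ennreal (a\<^sup>2 / 2 / (gap k)\<^sup>2) * ennreal ((anchor (Suc k) \<omega> - anchor k \<omega>)\<^sup>2) \<partial>M)"
      by (intro nn_integral_cong) (simp add: ennreal_mult[symmetric] power_divide)
    also have "\<dots> = ennreal (a\<^sup>2 / 2 / (gap k)\<^sup>2) * ennreal (step_energy k)"
      by (subst nn_integral_cmult) (simp_all only: step_energy_nn_integral, measurable)
    also have "\<dots> = ennreal (a\<^sup>2 / 2 * step_energy k / (gap k)\<^sup>2)"
      using step_energy_nonneg[of k] by (simp add: ennreal_mult[symmetric])
    finally show ?thesis by simp
  qed
  have "(\<integral>\<^sup>+\<omega>. (\<integral>\<^sup>+t. effort_bound t \<omega> \<partial>lborel) \<partial>M)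
    = (\<integral>\<^sup>+\<omega>. (\<integral>\<^sup>+t. follower_cost t \<omega> \<partial>lborel) +
        (\<integral>\<^sup>+t. (\<Sum>k. ennreal (a\<^sup>2 / 2 * ((anchor (Suc k) \<omega> - anchor k \<omega>) / gap k)\<^sup>2) * indicator (cell k) t) \<partial>lborel) \<partial>M)"
    unfolding effort_bound_def by (intro nn_integral_cong) (subst nn_integral_add, measurable)
  also have "\<dots> = (\<integral>\<^sup>+\<omega>. (\<integral>\<^sup>+t. follower_cost t \<omega> \<partial>lborel) \<partial>M) +
        (\<integral>\<^sup>+\<omega>. (\<integral>\<^sup>+t. (\<Sum>k. ennreal (a\<^sup>2 / 2 * ((anchor (Suc k) \<omega> - anchor k \<omega>) / gap k)\<^sup>2) * indicator (cell k) t) \<partial>lborel) \<partial>M)"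
    by (rule nn_integral_add) measurable
  also have "\<dots> \<le> ennreal (1 / 2) * Omega_term M T x \<xi> a + (\<Sum>k. ennreal (gap k * (a\<^sup>2 / 2 * step_energy k / (gap k)\<^sup>2)))"
    by (intro add_mono follower_cost_le nn_integral_cells_le step) measurable
  also have "(\<lambda>k. ennreal (gap k * (a\<^sup>2 / 2 * step_energy k / (gap k)\<^sup>2))) = (\<lambda>k. ennreal (a\<^sup>2 / 2 * (step_energy k / gap k)))"
  proof
    fix k
    show "ennreal (gap k * (a\<^sup>2 / 2 * step_energy k / (gap k)\<^sup>2)) = ennreal (a\<^sup>2 / 2 * (step_energy k / gap k))"
      using gap_pos[of k] by (intro arg_cong[where f=ennreal]) (simp add: field_simps power2_eq_square)
  qed
  finally show ?thesis .
qed

lemma bridge_control_square_le: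
  assumes "t \<in> {0..T}" "t \<noteq> T"
  shows "ennreal ((bridge_control t \<omega>)\<^sup>2) \<le> ennreal (2 / a\<^sup>2) * effort_bound t \<omega>"
proof (cases "t < \<tau>")
  case True
  have "ennreal ((bridge_control t \<omega>)\<^sup>2) = ennreal (2 / a\<^sup>2) * follower_cost t \<omega>"
    using True assms a_pos
    by (simp add: bridge_control_def follower_cost_def signal_eq ennreal_mult[symmetric] power_divide power2_commute)
  also have "\<dots> \<le> ennreal (2 / a\<^sup>2) * effort_bound t \<omega>"
    by (intro mult_left_mono) (auto simp: effort_bound_def)
  finally show ?thesis .
next
  case False
  then obtain k where k: "t \<in> cell k" using cell_exists[of t] assms by auto
  let ?f = "\<lambda>k. ennreal (a\<^sup>2 / 2 * ((anchor (Suc k) \<omega> - anchor k \<omega>) / gap k)\<^sup>2) * indicator (cell k) t"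
  have "ennreal ((bridge_control t \<omega>)\<^sup>2) = ennreal (2 / a\<^sup>2) * ?f k"
    using k a_pos by (simp add: bridge_control_cell[OF k] ennreal_mult[symmetric] del: anchor.simps)
  also have "\<dots> \<le> ennreal (2 / a\<^sup>2) * effort_bound t \<omega>"
  proof (rule mult_left_mono)
    have "?f k \<le> (\<Sum>k. ?f k)" by (rule ennreal_le_suminf)
    also have "\<dots> \<le> effort_bound t \<omega>"
      unfolding effort_bound_def by (rule add_increasing[OF zero_le order_refl])
    finally show "?f k \<le> effort_bound t \<omega>" .
  qed simp
  finally show ?thesis .
qed

lemma bridge_control_path_le:
  assumes "\<omega> \<in> space M"
  shows "(\<integral>\<^sup>+t\<in>{0..T}. ennreal ((bridge_control t \<omega>)\<^sup>2) \<partial>lborel) \<le> ennreal (2 / a\<^sup>2) * (\<integral>\<^sup>+t. effort_bound t \<omega> \<partial>lborel)"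
proof -
  have "(\<integral>\<^sup>+t\<in>{0..T}. ennreal ((bridge_control t \<omega>)\<^sup>2) \<partial>lborel) \<le> (\<integral>\<^sup>+t. ennreal (2 / a\<^sup>2) * effort_bound t \<omega> \<partial>lborel)"
  \<comment> \<open>The cells cover [\<tau>, T) but miss T, a Lebesgue null set.\<close>
  proof (rule nn_integral_mono_AE, use AE_lborel_singleton[of T] in eventually_elim)
    fix t assume "t \<noteq> T"
    then show "ennreal ((bridge_control t \<omega>)\<^sup>2) * indicator {0..T} t \<le> ennreal (2 / a\<^sup>2) * effort_bound t \<omega>"
      using bridge_control_square_le[of t \<omega>] by (auto simp: indicator_def)
  qed
  also have "\<dots> = ennreal (2 / a\<^sup>2) * (\<integral>\<^sup>+t. effort_bound t \<omega> \<partial>lborel)"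
    by (rule nn_integral_cmult) (use assms in measurable)
  finally show ?thesis .
qed

lemma bridge_control_energy_le:
  "mean_sq_energy M T bridge_control \<le> ennreal (2 / a\<^sup>2) * (\<integral>\<^sup>+\<omega>. (\<integral>\<^sup>+t. effort_bound t \<omega> \<partial>lborel) \<partial>M)"
proof -
  have "mean_sq_energy M T bridge_control \<le> (\<integral>\<^sup>+\<omega>. ennreal (2 / a\<^sup>2) * (\<integral>\<^sup>+t. effort_bound t \<omega> \<partial>lborel) \<partial>M)"
    unfolding mean_sq_energy_def by (intro nn_integral_mono bridge_control_path_le)
  also have "\<dots> = ennreal (2 / a\<^sup>2) * (\<integral>\<^sup>+\<omega>. (\<integral>\<^sup>+t. effort_bound t \<omega> \<partial>lborel) \<partial>M)"
    by (rule nn_integral_cmult) measurable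
  finally show ?thesis .
qed

text \<open>The Bochner integral in \<open>state\<close> describes the intended path only where the
  control path is integrable; the path formulas below are applied on this event of full
  probability.\<close>

lemma bridge_control_path_integrable:
  assumes "(\<integral>\<^sup>+\<omega>. (\<integral>\<^sup>+t. effort_bound t \<omega> \<partial>lborel) \<partial>M) < \<infinity>"
  shows "AE \<omega> in M. set_integrable lborel {0..T} (\<lambda>t. bridge_control t \<omega>)"
proof -
  have "AE \<omega> in M. (\<integral>\<^sup>+t. effort_bound t \<omega> \<partial>lborel) \<noteq> \<infinity>"
    using assms by (intro nn_integral_PInf_AE) (auto simp: less_top[symmetric])
  then show ?thesis using AE_space
  proof eventually_elim
    fix \<omega> assume fin: "(\<integral>\<^sup>+t. effort_bound t \<omega> \<partial>lborel) \<noteq> \<infinity>" and \<omega>: "\<omega> \<in> space M"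
    have m: "(\<lambda>t. bridge_control (clamp_time t) \<omega>) \<in> borel_measurable borel"
      using measurable_compose[OF measurable_Pair[OF measurable_ident measurable_const[OF \<omega>]]
          progressive_jointly_measurable[OF progressive_bridge_control]] by simp
    have "(\<integral>\<^sup>+t\<in>{0..T}. ennreal ((bridge_control (clamp_time t) \<omega>)\<^sup>2) \<partial>lborel)
        = (\<integral>\<^sup>+t\<in>{0..T}. ennreal ((bridge_control t \<omega>)\<^sup>2) \<partial>lborel)"
      by (intro nn_integral_cong) (auto simp: indicator_def clamp_time_id)
    also have "\<dots> \<le> ennreal (2 / a\<^sup>2) * (\<integral>\<^sup>+t. effort_bound t \<omega> \<partial>lborel)"
      by (rule bridge_control_path_le[OF \<omega>])
    also have "\<dots> < \<infinity>" using fin by (simp add: ennreal_mult_eq_top_iff less_top[symmetric])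
    finally have "set_integrable lborel {0..T} (\<lambda>t. bridge_control (clamp_time t) \<omega>)"
      by (rule set_integrable_of_square[OF m])
    then show "set_integrable lborel {0..T} (\<lambda>t. bridge_control t \<omega>)"
      by (rule set_integrable_cong[THEN iffD1, rotated 3]) (auto simp: clamp_time_id)
  qed
qed

section \<open>The path of the controlled state\<close>

lemma state_before_switch:
  assumes \<omega>: "\<omega> \<in> space M" and s: "set_integrable lborel {0..T} (\<lambda>t. signal t \<omega>)"
    and u: "set_integrable lborel {0..T} (\<lambda>t. bridge_control t \<omega>)"
    and t: "0 \<le> t" "t \<le> \<tau>"
  shows "state x bridge_control t \<omega> = follower t \<omega>"
proof -
  define Y where "Y = tracking a x (\<lambda>s. signal s \<omega>)"
  have sub: "{0..t} \<subseteq> {0..T}" using t tau_bounds by auto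
  have st: "set_integrable lborel {0..t} (\<lambda>t. signal t \<omega>)"
    and ut: "set_integrable lborel {0..t} (\<lambda>t. bridge_control t \<omega>)"
    by (rule set_integrable_subset[OF s] set_integrable_subset[OF u]; use sub in simp)+
  note eq = tracking_integral_equation[OF a_pos t(1) signal_path_measurable[OF \<omega>] st, of x, folded Y_def]
  have dt: "set_integrable lborel {0..t} (\<lambda>s. (signal s \<omega> - Y s) / a)"
    by (intro set_integrable_divide set_integral_diff(1) st eq(1))
  have "(LBINT s:{0..t}. bridge_control s \<omega>) = (LBINT s:{0..t}. (signal s \<omega> - Y s) / a)"
    unfolding set_lebesgue_integral_def
  proof (rule integral_cong_AE)
    show "AE s in lborel. indicator {0..t} s *\<^sub>R bridge_control s \<omega> = indicator {0..t} s *\<^sub>R ((signal s \<omega> - Y s) / a)"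
      \<comment> \<open>At \<tau> itself the control already takes its value from the first
        cell.\<close>
      using AE_lborel_singleton[of \<tau>]
      by eventually_elim
         (use t tau_bounds in \<open>auto simp: indicator_def bridge_control_def signal_eq follower_def Y_def clamp_time_id\<close>)
  qed (use ut dt in \<open>auto simp: set_integrable_def\<close>)
  then show ?thesis
    using eq(2) t tau_bounds by (simp add: state_def follower_def Y_def clamp_time_id)
qed

lemma state_increment:
  assumes u: "set_integrable lborel {0..T} (\<lambda>t. bridge_control t \<omega>)"
    and t: "t \<in> {node k..node (Suc k)}"
  shows "state x bridge_control t \<omega> = state x bridge_control (node k) \<omega>
    + (t - node k) / gap k * (anchor (Suc k) \<omega> - anchor k \<omega>)"
proof -
  define c where "c = (anchor (Suc k) \<omega> - anchor k \<omega>) / gap k"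
  have T: "t \<le> T" using t node_less[of "Suc k"] by simp
  have u1: "set_integrable lborel {0..node k} (\<lambda>t. bridge_control t \<omega>)"
    and u2: "set_integrable lborel {node k<..t} (\<lambda>t. bridge_control t \<omega>)"
    by (rule set_integrable_subset[OF u]; use T node_mem[of k] in auto)+
  have split: "{0..t} = {0..node k} \<union> {node k<..t}" using t node_mem[of k] by auto
  have "(LBINT s:{0..t}. bridge_control s \<omega>)
    = (LBINT s:{0..node k}. bridge_control s \<omega>) + (LBINT s:{node k<..t}. bridge_control s \<omega>)"
    unfolding split by (rule set_integral_Un[OF _ u1 u2]) auto
  also have "(LBINT s:{node k<..t}. bridge_control s \<omega>) = (LBINT s:{node k<..t}. c)"
    unfolding set_lebesgue_integral_def
  proof (rule integral_cong_AE)
    show "AE s in lborel. indicator {node k<..t} s *\<^sub>R bridge_control s \<omega> = indicator {node k<..t} s *\<^sub>R c"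
      \<comment> \<open>Cells are closed on the left, while the integral runs over an interval
        closed on the right; for t = \<open>node (Suc k)\<close> the right endpoint is outside the
        cell.\<close>
      using AE_lborel_singleton[of "node (Suc k)"]
    proof eventually_elim
      fix s assume "s \<noteq> node (Suc k)"
      then have "s \<in> cell k" if "s \<in> {node k<..t}" using that t by (auto simp: cell_def)
      then show "indicator {node k<..t} s *\<^sub>R bridge_control s \<omega> = indicator {node k<..t} s *\<^sub>R c"
        using bridge_control_cell[of s k \<omega>] unfolding c_def by (cases "s \<in> {node k<..t}") simp_all
    qed
  qed (use u2 in \<open>auto simp: set_integrable_def\<close>)
  also have "\<dots> = (t - node k) * c"
    using t by (simp add: set_lebesgue_integral_def)
  finally show ?thesis by (simp add: state_def c_def)
qed

lemma state_node:
  assumes "\<omega> \<in> space M" "set_integrable lborel {0..T} (\<lambda>t. signal t \<omega>)"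
    "set_integrable lborel {0..T} (\<lambda>t. bridge_control t \<omega>)"
  shows "state x bridge_control (node k) \<omega> = anchor k \<omega>"
proof (induction k)
  case 0
  then show ?case using state_before_switch[OF assms, of \<tau>] tau_bounds by (simp add: node_0)
next
  case (Suc k)
  have "node (Suc k) \<in> {node k..node (Suc k)}" using incseqD[OF node_incseq, of k "Suc k"] by simp
  from state_increment[OF assms(3) this] Suc gap_pos[of k] show ?case
    by (simp add: node_Suc del: anchor.simps)
qed

lemma state_cell:
  assumes "\<omega> \<in> space M" "set_integrable lborel {0..T} (\<lambda>t. signal t \<omega>)"
    "set_integrable lborel {0..T} (\<lambda>t. bridge_control t \<omega>)" "t \<in> cell k"
  shows "state x bridge_control t \<omega> = segment k t \<omega>"
  using state_increment[OF assms(3), of t k] state_node[OF assms(1-3), of k] assms(4)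
  by (simp add: cell_def segment_def del: anchor.simps)

text \<open>Continuity of the state at T: the control is integrable up to T, and its restrictions to
  [0, \<open>node k\<close>] converge to it off the single time T under this integrable
  bound.\<close>

lemma anchor_tendsto_state:
  assumes "\<omega> \<in> space M" "set_integrable lborel {0..T} (\<lambda>t. signal t \<omega>)"
    and u: "set_integrable lborel {0..T} (\<lambda>t. bridge_control t \<omega>)"
  shows "(\<lambda>k. anchor k \<omega>) \<longlonglongrightarrow> state x bridge_control T \<omega>"
proof -
  have "(\<lambda>k. \<integral>s. indicator {0..node k} s *\<^sub>R bridge_control s \<omega> \<partial>lborel)
      \<longlonglongrightarrow> (\<integral>s. indicator {0..T} s *\<^sub>R bridge_control s \<omega> \<partial>lborel)"
  proof (rule integral_dominated_convergence)
    show "integrable lborel (\<lambda>s. norm (indicator {0..T} s *\<^sub>R bridge_control s \<omega>))"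
      using u unfolding set_integrable_def by (rule integrable_norm)
    show "(\<lambda>s. indicator {0..node k} s *\<^sub>R bridge_control s \<omega>) \<in> borel_measurable lborel" for k
    proof -
      have "set_integrable lborel {0..node k} (\<lambda>t. bridge_control t \<omega>)"
        by (rule set_integrable_subset[OF u]) (use node_mem in auto)
      then show ?thesis unfolding set_integrable_def by (rule borel_measurable_integrable)
    qed
    show "AE s in lborel. (\<lambda>k. indicator {0..node k} s *\<^sub>R bridge_control s \<omega>)
        \<longlonglongrightarrow> indicator {0..T} s *\<^sub>R bridge_control s \<omega>"
      using AE_lborel_singleton[of T]
    proof eventually_elim
      fix s assume "s \<noteq> T"
      have "eventually (\<lambda>k. indicator {0..node k} s *\<^sub>R bridge_control s \<omega> = indicator {0..T} s *\<^sub>R bridge_control s \<omega>) sequentially"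
      proof (cases "s < T")
        case True
        from order_tendstoD(1)[OF node_tendsto this] show ?thesis
          by eventually_elim (use True in \<open>auto simp: indicator_def\<close>)
      next
        case False
        then have "s \<notin> {0..node k}" "s \<notin> {0..T}" for k
          using \<open>s \<noteq> T\<close> node_less[of k] by auto
        then show ?thesis by simp
      qed
      then show "(\<lambda>k. indicator {0..node k} s *\<^sub>R bridge_control s \<omega>) \<longlonglongrightarrow> indicator {0..T} s *\<^sub>R bridge_control s \<omega>"
        by (rule tendsto_eventually)
    qed
    show "AE s in lborel. norm (indicator {0..node k} s *\<^sub>R bridge_control s \<omega>)
        \<le> norm (indicator {0..T} s *\<^sub>R bridge_control s \<omega>)" for k
      using node_mem[of k] by (intro AE_I2) (auto simp: indicator_def)
  qed (use u in \<open>auto simp: set_integrable_def\<close>)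
  then have "(\<lambda>k. state x bridge_control (node k) \<omega>) \<longlonglongrightarrow> state x bridge_control T \<omega>"
    unfolding state_def set_lebesgue_integral_def by (intro tendsto_intros)
  then show ?thesis by (simp add: state_node[OF assms])
qed

text \<open>The factor 2 \<open>gap k\<close> is the remaining time at \<open>node k\<close>, so
  finite \<Lambda> forces convergence of the anchors to \<open>\<Xi>T\<close> in mean
  square.\<close>

lemma anchor_error_le:
  "(\<integral>\<^sup>+\<omega>. ennreal ((anchor (Suc k) \<omega> - \<Xi>T \<omega>)\<^sup>2) \<partial>M) \<le> Lambda_term M T \<Xi> a * ennreal (2 * gap k)"
proof -
  have "(\<integral>\<^sup>+\<omega>. ennreal ((anchor (Suc k) \<omega> - \<Xi>T \<omega>)\<^sup>2) \<partial>M) = (\<integral>\<^sup>+\<omega>. ennreal ((\<Xi> T \<omega> - \<Xi> (node k) \<omega>)\<^sup>2) \<partial>M)"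
  proof (rule nn_integral_cong_AE, use Xi_terminal in eventually_elim)
    fix \<omega> assume "\<Xi> T \<omega> = \<Xi>T \<omega>"
    then show "ennreal ((anchor (Suc k) \<omega> - \<Xi>T \<omega>)\<^sup>2) = ennreal ((\<Xi> T \<omega> - \<Xi> (node k) \<omega>)\<^sup>2)"
      by (simp add: target_eq node_mem power2_commute)
  qed
  also have "\<dots> = ennreal (\<integral>\<omega>. (\<Xi> T \<omega> - \<Xi> (node k) \<omega>)\<^sup>2 \<partial>M)"
    by (intro square_integrable_nn_integral square_integrable_diff Xi_square_integrable)
       (use T_pos node_mem in auto)
  also have "\<dots> = ennreal (second_moment T - second_moment (node k))"
    by (subst Xi_increment) (use node_mem in auto)
  also have "\<dots> \<le> ennreal (2 * gap k) * reach_increment (node k) T"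
    using second_moment_increment_le[of "node k" T] node_mem[of k] by (simp add: remaining_eq)
  also have "\<dots> \<le> ennreal (2 * gap k) * Lambda_term M T \<Xi> a"
    unfolding reach_increment_def Lambda_term_def reach_integral_def
    using node_ge[of k] tau by (intro nn_integral_mono mult_left_mono indicator_leI) auto
  finally show ?thesis by (simp only: mult.commute)
qed

text \<open>The anchors converge almost surely to the terminal state and in mean square to
  \<open>\<Xi>T\<close>. Fatou's lemma identifies the two limits without passing to a
  subsequence.\<close>

lemma state_terminal:
  assumes effort: "(\<integral>\<^sup>+\<omega>. (\<integral>\<^sup>+t. effort_bound t \<omega> \<partial>lborel) \<partial>M) < \<infinity>"
    and reach: "Lambda_term M T \<Xi> a < \<infinity>"
  shows "AE \<omega> in M. state x bridge_control T \<omega> = \<Xi>T \<omega>"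
proof -
  define f where "f = (\<lambda>k \<omega>. ennreal ((anchor (Suc k) \<omega> - \<Xi>T \<omega>)\<^sup>2))"
  have [measurable]: "\<Xi>T \<in> borel_measurable M"
    using XiT_square_integrable by (simp add: square_integrable_def)
  have [measurable]: "f k \<in> borel_measurable M" for k
    unfolding f_def by measurable
  have "(\<lambda>k. T - node k) \<longlonglongrightarrow> T - T" by (intro tendsto_intros node_tendsto)
  then have "(\<lambda>k. ennreal (2 * gap k)) \<longlonglongrightarrow> ennreal 0"
    unfolding remaining_eq by (intro tendsto_ennrealI) simp
  \<comment> \<open>Multiplication by a constant preserves the limit 0 here because \<Lambda> is
    finite.\<close>
  from ennreal_tendsto_cmult[OF _ this] reach
  have "(\<lambda>k. Lambda_term M T \<Xi> a * ennreal (2 * gap k)) \<longlonglongrightarrow> 0" by simp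
  then have lim: "liminf (\<lambda>k. Lambda_term M T \<Xi> a * ennreal (2 * gap k)) = 0"
    by (intro lim_imp_Liminf) auto
  have "(\<integral>\<^sup>+\<omega>. liminf (\<lambda>k. f k \<omega>) \<partial>M) \<le> liminf (\<lambda>k. \<integral>\<^sup>+\<omega>. f k \<omega> \<partial>M)"
    by (rule nn_integral_liminf) measurable
  also have "\<dots> \<le> liminf (\<lambda>k. Lambda_term M T \<Xi> a * ennreal (2 * gap k))"
    unfolding f_def by (intro Liminf_mono always_eventually allI anchor_error_le)
  finally have "(\<integral>\<^sup>+\<omega>. liminf (\<lambda>k. f k \<omega>) \<partial>M) = 0" using lim by simp
  then have "AE \<omega> in M. liminf (\<lambda>k. f k \<omega>) = 0"
    by (subst (asm) nn_integral_0_iff_AE) auto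
  then show ?thesis
    using signal_path_integrable bridge_control_path_integrable[OF effort] AE_space
  proof eventually_elim
    fix \<omega> assume z: "liminf (\<lambda>k. f k \<omega>) = 0" and "set_integrable lborel {0..T} (\<lambda>t. signal t \<omega>)"
      "set_integrable lborel {0..T} (\<lambda>t. bridge_control t \<omega>)" "\<omega> \<in> space M"
    then have "(\<lambda>k. anchor (Suc k) \<omega>) \<longlonglongrightarrow> state x bridge_control T \<omega>"
      by (intro LIMSEQ_Suc anchor_tendsto_state)
    then have "(\<lambda>k. f k \<omega>) \<longlonglongrightarrow> ennreal ((state x bridge_control T \<omega> - \<Xi>T \<omega>)\<^sup>2)"
      unfolding f_def by (intro tendsto_intros)
    then have "liminf (\<lambda>k. f k \<omega>) = ennreal ((state x bridge_control T \<omega> - \<Xi>T \<omega>)\<^sup>2)"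
      by (intro lim_imp_Liminf) auto
    with z show "state x bridge_control T \<omega> = \<Xi>T \<omega>" by (simp add: ennreal_eq_0_iff)
  qed
qed

text \<open>From \<tau> on, the error is split at \<Xi>, and t lies in the window of \<Theta> since
  \<tau> \<ge> T - 2a. The factor 2 cancels the 1/2 in the cost, so before \<tau> nothing is
  lost.\<close>

lemma deviation_square_le:
  assumes "\<omega> \<in> space M" "set_integrable lborel {0..T} (\<lambda>t. signal t \<omega>)"
    "set_integrable lborel {0..T} (\<lambda>t. bridge_control t \<omega>)" and t: "t \<in> {0..T}" "t \<noteq> T"
  shows "ennreal ((state x bridge_control t \<omega> - \<xi> t \<omega>)\<^sup>2) \<le> 2 * deviation_bound t \<omega>"
proof (cases "t < \<tau>")
  case True
  have "ennreal ((state x bridge_control t \<omega> - \<xi> t \<omega>)\<^sup>2) = 2 * follower_cost t \<omega>"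
    using True t state_before_switch[OF assms(1-3), of t]
    by (simp add: follower_cost_def signal_eq ennreal_mult[symmetric] flip: ennreal_numeral)
  also have "\<dots> \<le> 2 * deviation_bound t \<omega>"
    by (intro mult_left_mono) (auto simp: deviation_bound_def)
  finally show ?thesis .
next
  case False
  then obtain k where k: "t \<in> cell k" using cell_exists[of t] t by auto
  let ?f = "\<lambda>k. ennreal ((segment k t \<omega> - target t \<omega>)\<^sup>2) * indicator (cell k) t"
  have "ennreal ((state x bridge_control t \<omega> - \<xi> t \<omega>)\<^sup>2)
      \<le> ennreal (2 * (segment k t \<omega> - target t \<omega>)\<^sup>2 + 2 * (signal t \<omega> - target t \<omega>)\<^sup>2)"
    using square_add_le[of "segment k t \<omega> - target t \<omega>" "target t \<omega> - signal t \<omega>"]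
      state_cell[OF assms(1-3) k] t
    by (intro ennreal_leI) (simp add: signal_eq power2_commute)
  also have "\<dots> = 2 * (?f k + ennreal ((signal t \<omega> - target t \<omega>)\<^sup>2) * indicator {T - 2 * a..T} t)"
    using k False t tau by (simp add: ennreal_plus ennreal_mult distrib_left)
  also have "\<dots> \<le> 2 * ((\<Sum>k. ?f k) + ennreal ((signal t \<omega> - target t \<omega>)\<^sup>2) * indicator {T - 2 * a..T} t)"
    by (intro mult_left_mono add_right_mono ennreal_le_suminf) simp
  also have "\<dots> \<le> 2 * deviation_bound t \<omega>"
    by (intro mult_left_mono) (auto simp: deviation_bound_def)
  finally show ?thesis .
qed

text \<open>Finite effort is what allows \<open>state\<close> to be evaluated by the path formulas
  almost surely. The weights 1/2 and a^2/2 of the cost then cancel the factors 2 and 2/a^2 of the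
  pointwise bounds.\<close>

lemma bridge_cost_le:
  assumes effort: "(\<integral>\<^sup>+\<omega>. (\<integral>\<^sup>+t. effort_bound t \<omega> \<partial>lborel) \<partial>M) < \<infinity>"
  shows "cost M T x \<xi> (a\<^sup>2) bridge_control
    \<le> (\<integral>\<^sup>+\<omega>. (\<integral>\<^sup>+t. deviation_bound t \<omega> \<partial>lborel) \<partial>M) + (\<integral>\<^sup>+\<omega>. (\<integral>\<^sup>+t. effort_bound t \<omega> \<partial>lborel) \<partial>M)"
proof -
  have half: "ennreal (1 / 2) * 2 = 1"
    using ennreal_mult'[of "1 / 2" 2] by simp
  have "cost M T x \<xi> (a\<^sup>2) bridge_control
    \<le> (\<integral>\<^sup>+\<omega>. (\<integral>\<^sup>+t. deviation_bound t \<omega> \<partial>lborel) + (\<integral>\<^sup>+t. effort_bound t \<omega> \<partial>lborel) \<partial>M)"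
    unfolding cost_def
  proof (rule nn_integral_mono_AE, use signal_path_integrable bridge_control_path_integrable[OF effort] AE_space in eventually_elim)
    fix \<omega> assume \<omega>: "set_integrable lborel {0..T} (\<lambda>t. signal t \<omega>)"
      "set_integrable lborel {0..T} (\<lambda>t. bridge_control t \<omega>)" "\<omega> \<in> space M"
    have "(\<integral>\<^sup>+t\<in>{0..T}. ennreal ((state x bridge_control t \<omega> - \<xi> t \<omega>)\<^sup>2) \<partial>lborel) \<le> (\<integral>\<^sup>+t. 2 * deviation_bound t \<omega> \<partial>lborel)"
    proof (rule nn_integral_mono_AE, use AE_lborel_singleton[of T] in eventually_elim)
      fix t assume "t \<noteq> T"
      then show "ennreal ((state x bridge_control t \<omega> - \<xi> t \<omega>)\<^sup>2) * indicator {0..T} t \<le> 2 * deviation_bound t \<omega>"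
        using deviation_square_le[OF \<omega>(3,1,2), of t] by (auto simp: indicator_def)
    qed
    also have "\<dots> = 2 * (\<integral>\<^sup>+t. deviation_bound t \<omega> \<partial>lborel)"
      by (rule nn_integral_cmult) (use \<omega>(3) in measurable)
    finally have "ennreal (1 / 2) * (\<integral>\<^sup>+t\<in>{0..T}. ennreal ((state x bridge_control t \<omega> - \<xi> t \<omega>)\<^sup>2) \<partial>lborel)
        \<le> ennreal (1 / 2) * (2 * (\<integral>\<^sup>+t. deviation_bound t \<omega> \<partial>lborel))"
      by (rule mult_left_mono) simp
    also have "\<dots> = (\<integral>\<^sup>+t. deviation_bound t \<omega> \<partial>lborel)"
      by (simp only: mult.assoc[symmetric] half mult_1_left)
    finally have 1: "ennreal (1 / 2) * (\<integral>\<^sup>+t\<in>{0..T}. ennreal ((state x bridge_control t \<omega> - \<xi> t \<omega>)\<^sup>2) \<partial>lborel)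
        \<le> (\<integral>\<^sup>+t. deviation_bound t \<omega> \<partial>lborel)" .
    have "ennreal (a\<^sup>2 / 2) * (\<integral>\<^sup>+t\<in>{0..T}. ennreal ((bridge_control t \<omega>)\<^sup>2) \<partial>lborel)
        \<le> ennreal (a\<^sup>2 / 2) * (ennreal (2 / a\<^sup>2) * (\<integral>\<^sup>+t. effort_bound t \<omega> \<partial>lborel))"
      by (intro mult_left_mono bridge_control_path_le \<omega>(3)) simp
    also have "\<dots> = (\<integral>\<^sup>+t. effort_bound t \<omega> \<partial>lborel)"
      using a_pos by (simp add: mult.assoc[symmetric] ennreal_mult[symmetric])
    finally show "ennreal (1 / 2) * (\<integral>\<^sup>+t\<in>{0..T}. ennreal ((state x bridge_control t \<omega> - \<xi> t \<omega>)\<^sup>2) \<partial>lborel)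
        + ennreal (a\<^sup>2 / 2) * (\<integral>\<^sup>+t\<in>{0..T}. ennreal ((bridge_control t \<omega>)\<^sup>2) \<partial>lborel)
        \<le> (\<integral>\<^sup>+t. deviation_bound t \<omega> \<partial>lborel) + (\<integral>\<^sup>+t. effort_bound t \<omega> \<partial>lborel)"
      using 1 by (intro add_mono)
  qed
  also have "\<dots> = (\<integral>\<^sup>+\<omega>. (\<integral>\<^sup>+t. deviation_bound t \<omega> \<partial>lborel) \<partial>M) + (\<integral>\<^sup>+\<omega>. (\<integral>\<^sup>+t. effort_bound t \<omega> \<partial>lborel) \<partial>M)"
    by (rule nn_integral_add) measurable
  finally show ?thesis .
qed

end

section \<open>Admissibility of the bridge and the final constants\<close>

context tracking_problem
begin

lemma constrained_value_le:
  assumes reach: "Lambda_term M T \<Xi> a < \<infinity>"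
  shows "constrained_value M F T x \<xi> \<Xi>T (a\<^sup>2)
    \<le> 6 * (Omega_term M T x \<xi> a + Theta_term M T \<xi> \<Xi> a + ennreal (a\<^sup>2) * Lambda_term M T \<Xi> a)"
proof -
  define \<Omega> where "\<Omega> = Omega_term M T x \<xi> a"
  define \<Theta> where "\<Theta> = Theta_term M T \<xi> \<Xi> a"
  define \<Lambda> where "\<Lambda> = Lambda_term M T \<Xi> a"
  show ?thesis
  proof (cases "\<Omega> + \<Theta> < \<infinity>")
    \<comment> \<open>An infinite \<Omega> or \<Theta> makes the claim trivial; otherwise the
      distance at \<tau> has a finite second moment, as the bridge requires.\<close>
    case False
    then have "\<Omega> + \<Theta> = top" by (simp add: less_top[symmetric])
    then have "6 * (\<Omega> + \<Theta> + ennreal (a\<^sup>2) * \<Lambda>) = top"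
      by (simp only: top_add) (simp add: ennreal_mult_top)
    then show ?thesis
      unfolding \<Omega>_def \<Theta>_def \<Lambda>_def by (simp only: top_greatest)
  next
    case True
    obtain \<tau> where \<tau>: "\<tau> \<in> {T - 2 * a..T - a}"
      and dist: "(\<integral>\<^sup>+\<omega>. ennreal ((target \<tau> \<omega> - follower \<tau> \<omega>)\<^sup>2) \<partial>M) \<le> ennreal (2 / a) * (\<Omega> + \<Theta>)"
      unfolding \<Omega>_def \<Theta>_def by (rule exists_switching_time)
    have "ennreal (2 / a) * (\<Omega> + \<Theta>) < \<infinity>"
      using True by (simp add: ennreal_mult_less_top)
    with dist have "(\<integral>\<^sup>+\<omega>. ennreal ((target \<tau> \<omega> - follower \<tau> \<omega>)\<^sup>2) \<partial>M) < \<infinity>"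
      by (rule order_le_less_trans)
    then have "square_integrable M (\<lambda>\<omega>. target \<tau> \<omega> - follower \<tau> \<omega>)"
      by (subst square_integrable_iff) auto
    with \<tau> interpret dyadic_bridge M F T \<Xi>T \<Xi> \<xi> x a \<tau>
      by unfold_locales
    define S1 where "S1 = (\<Sum>k. ennreal (gap k * (step_energy k + step_energy (Suc k))))"
    define S2 where "S2 = (\<Sum>k. ennreal (a\<^sup>2 / 2 * (step_energy k / gap k)))"
    have "ennreal (3 / 2 * a * step_energy 0) = ennreal (3 / 2 * a) * ennreal (step_energy 0)"
      using a_pos by (intro ennreal_mult step_energy_nonneg) simp
    also have "ennreal (step_energy 0) \<le> ennreal (2 / a) * (\<Omega> + \<Theta>)"
      using dist step_energy_nn_integral[of 0] by (simp add: node_0)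
    \<comment> \<open>The length scale cancels between the weight 3a/2 of the first step and the
      average bound 2/a.\<close>
    also have "ennreal (3 / 2 * a) * (ennreal (2 / a) * (\<Omega> + \<Theta>)) = 3 * (\<Omega> + \<Theta>)"
      using a_pos by (simp add: mult.assoc[symmetric] ennreal_mult[symmetric] flip: ennreal_numeral)
    finally have d0: "ennreal (3 / 2 * a * step_energy 0) \<le> 3 * (\<Omega> + \<Theta>)"
      by (simp add: mult_left_mono)
    have S: "S1 + S2 \<le> 3 * (\<Omega> + \<Theta>) + 5 * (ennreal (a\<^sup>2) * \<Lambda>)"
    proof -
      have "S1 + S2 \<le> ennreal (3 / 2 * a * step_energy 0) + ennreal (5 * a\<^sup>2) * \<Lambda>"
        unfolding S1_def S2_def \<Lambda>_def by (rule bridge_energy_le)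
      also have "\<dots> \<le> 3 * (\<Omega> + \<Theta>) + ennreal (5 * a\<^sup>2) * \<Lambda>"
        by (intro add_right_mono d0)
      also have "ennreal (5 * a\<^sup>2) = 5 * ennreal (a\<^sup>2)"
        by (simp add: ennreal_mult)
      finally show ?thesis by (simp add: mult.assoc)
    qed
    \<comment> \<open>Finiteness comes before the cost estimate: it yields finite effort, on which
      admissibility, the terminal constraint and the evaluation of the cost all rest.\<close>
    have "3 * (\<Omega> + \<Theta>) + 5 * (ennreal (a\<^sup>2) * \<Lambda>) < \<infinity>"
      using True reach by (simp add: ennreal_mult_less_top \<Lambda>_def)
    moreover have "S2 \<le> S1 + S2" by simp
    ultimately have "S2 < \<infinity>" using S by (meson order_le_less_trans)
    then have "ennreal (1 / 2) * \<Omega> + S2 < \<infinity>"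
      using True ennreal_less_top[of "1 / 2"] by (simp add: ennreal_mult_less_top)
    with effort_bound_le have effort: "(\<integral>\<^sup>+\<omega>. (\<integral>\<^sup>+t. effort_bound t \<omega> \<partial>lborel) \<partial>M) < \<infinity>"
      unfolding S2_def \<Omega>_def by (rule order_le_less_trans)
    have "mean_sq_energy M T bridge_control < \<infinity>"
      by (rule order_le_less_trans[OF bridge_control_energy_le])
         (use effort in \<open>simp add: ennreal_mult_less_top\<close>)
    then have "bridge_control \<in> constrained_controls M F T x \<Xi>T"
      using progressive_bridge_control state_terminal[OF effort reach]
      by (simp add: constrained_controls_def controls_def)
    then have "constrained_value M F T x \<xi> \<Xi>T (a\<^sup>2) \<le> cost M T x \<xi> (a\<^sup>2) bridge_control"
      unfolding constrained_value_def by (rule INF_lower)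
    also have "\<dots> \<le> (ennreal (1 / 2) * \<Omega> + (S1 + \<Theta>)) + (ennreal (1 / 2) * \<Omega> + S2)"
      using bridge_cost_le[OF effort] add_mono[OF deviation_bound_le effort_bound_le]
      unfolding \<Omega>_def \<Theta>_def S1_def S2_def by (rule order_trans)
    also have "\<dots> = (ennreal (1 / 2) + ennreal (1 / 2)) * \<Omega> + \<Theta> + (S1 + S2)"
      by (simp only: distrib_left distrib_right ac_simps)
    also have "ennreal (1 / 2) + ennreal (1 / 2) = 1"
      using ennreal_plus[of "1 / 2" "1 / 2", symmetric] by simp
    also have "1 * \<Omega> + \<Theta> + (S1 + S2) \<le> 1 * \<Omega> + \<Theta> + (3 * (\<Omega> + \<Theta>) + 5 * (ennreal (a\<^sup>2) * \<Lambda>))"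
      by (intro add_left_mono S)
    also have "\<dots> = 4 * (\<Omega> + \<Theta>) + 5 * (ennreal (a\<^sup>2) * \<Lambda>)"
    proof -
      have "4 * (\<Omega> + \<Theta>) = (1 + 3) * (\<Omega> + \<Theta>)" by simp
      then show ?thesis by (simp only: distrib_right add.assoc mult_1_left)
    qed
    \<comment> \<open>The constants obtained, 4 and 5, are rounded up to the common 6.\<close>
    also have "\<dots> \<le> 6 * (\<Omega> + \<Theta>) + 6 * (ennreal (a\<^sup>2) * \<Lambda>)"
      by (intro add_mono mult_right_mono) auto
    finally show ?thesis
      unfolding \<Omega>_def \<Theta>_def \<Lambda>_def by (simp add: distrib_left)
  qed
qed

end

theorem theorem3p1:
  fixes M :: "'a measure" and F :: "real \<Rightarrow> 'a measure" and T x \<kappa> :: real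
    and \<xi> \<Xi> :: "real \<Rightarrow> 'a \<Rightarrow> real" and \<Xi>T :: "'a \<Rightarrow> real"
  assumes space: "usual_filtered_prob_space M F T"
    and xi_prog: "progressive F T \<xi>"
    and xi_0: "integrable M (\<lambda>\<omega>. (\<xi> 0 \<omega>)\<^sup>2)"
    and xi_L2: "mean_sq_energy M T \<xi> < \<infinity>"
    and XiT_meas: "\<Xi>T \<in> borel_measurable (F T)"
    and XiT_L2: "integrable M (\<lambda>\<omega>. (\<Xi>T \<omega>)\<^sup>2)"
    and Xi: "cadlag_martingale_version M F T \<Xi>T \<Xi>"
    and reachable: "reach_integral M T \<Xi> 0 < \<infinity>"
    and kappa: "\<kappa> \<in> {0<..T\<^sup>2 / 4}"
  shows "let a = sqrt \<kappa> in
    constrained_value M F T x \<xi> \<Xi>T \<kappa>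
      \<le> 6 * (Omega_term M T x \<xi> a + Theta_term M T \<xi> \<Xi> a + ennreal (a\<^sup>2) * Lambda_term M T \<Xi> a)"
proof -
  interpret usual_filtered_prob_space M F T by (rule space)
  define a where "a = sqrt \<kappa>"
  have a: "0 < a" "a\<^sup>2 = \<kappa>" using kappa by (auto simp: a_def)
  \<comment> \<open>The upper bound on \<kappa> means 2a \<le> T: the window [T - 2a, T] lies in the
    time horizon.\<close>
  have "a \<le> sqrt ((T / 2)\<^sup>2)"
    unfolding a_def using kappa by (intro real_sqrt_le_mono) (simp add: power_divide)
  then have a_le: "2 * a \<le> T" using T_pos by simp
  interpret tracking_problem M F T \<Xi>T \<Xi> \<xi> x a
    by unfold_locales (use xi_prog xi_L2 XiT_meas XiT_L2 Xi a a_le in auto)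
  \<comment> \<open>Since T - 2a \<ge> 0, reachability from time 0 makes the part of the integral
    near T finite.\<close>
  have "Lambda_term M T \<Xi> a \<le> reach_integral M T \<Xi> 0"
    unfolding Lambda_term_def reach_integral_def
    using a_le by (intro nn_integral_mono mult_left_mono indicator_leI) auto
  with reachable have "Lambda_term M T \<Xi> a < \<infinity>" by (rule order_le_less_trans[rotated])
  from constrained_value_le[OF this] show ?thesis
    unfolding Let_def a_def[symmetric] a(2) .
qed

end
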